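(* Let $Z$ be a Banach space having a $\lambda$-EAB $(P_\alpha)_{\alpha\in\mathscr{D}}$ with $\lambda<2$. Assume that $X$ is a subspace of $Z$ that fails the weak-FPP for $\mathfrak{cm}$-nonexpansive maps. Then $X$ has a spreading model isomorphic to $\ell_1$.
   Context: A Banach space $X$ has an extended $\lambda$-approximative basis ($\lambda$-EAB), $\lambda\geq 1$, if there is a net of finite rank operators $(P_\alpha)_{\alpha\in\mathscr{D}}$ on $X$ such that $x=\lim_{\alpha\in\mathscr{D}}P_\alpha(x)$ for all $x\in X$ and $\sup_{\alpha\in\mathscr{D}}\|P_\alpha\|\leq\lambda$. Let $C$ be a bounded convex subset of a Banach space $X$. A nonexpansive map $T\colon C\to C$ is called $\mathfrak{cm}$-nonexpansive if \[ \limsup_{i\to\infty} \sup_{A\subset\{1,\dots, n\}}\Big\|\sum_{k\in A} \big(T u_{i+k} - Ty\big)\Big\|\leq \limsup_{i\to\infty} \sup_{A\subset\{1,\dots, n\}}\Big\|\sum_{k\in A} (u_{i+k} - y)\Big\| \] for all $n\in\mathbb{N}$, $y\in C$ and all sequences $(u_i)_{i=1}^\infty\subset C$. A space has the weak-FPP for $\mathfrak{cm}$-nonexpansive maps if for every weakly compact convex set $C\subset X$, every $\mathfrak{cm}$-nonexpansive map $T\colon C\to C$ has a fixed point. Spreading models (Brunel–Sucheston): a bounded sequence $(x_n)$ in $X$ generates a spreading model if there exist a subsequence $(x_{n_i})$, a seminormed space $(E,|\!|\!|\cdot|\!|\!|)$ and a sequence $(e_i)\subset E$ such that for any $n\in\mathbb{N}$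 and $\varepsilon>0$ there is $n_0$ so that for all $n_0\leq\kappa_1<\dots<\kappa_n$ and $(a_i)_{i=1}^n\in[-1,1]^n$, $\big|\,\|\sum_{i=1}^n a_i x_{\kappa_i}\| - |\!|\!|\sum_{i=1}^n a_ie_i|\!|\!|\,\big|<\varepsilon$. The space $E$ is the spreading model; it is isomorphic to $\ell_1$ when $(e_i)$ is equivalent to the unit vector basis of $\ell_1$. *)

theory Defs
  imports "HOL-Analysis.Analysis"
begin

definition bounded_linear_functional_on :: "'a::real_normed_vector set \<Rightarrow> ('a \<Rightarrow> real) \<Rightarrow> bool" where
  "bounded_linear_functional_on X f \<longleftrightarrow>
     (\<forall>x\<in>X. \<forall>y\<in>X. f (x + y) = f x + f y) \<and>
     (\<forall>c. \<forall>x\<in>X. f (c *\<^sub>R x) = c * f x) \<and>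
     (\<exists>K. \<forall>x\<in>X. \<bar>f x\<bar> \<le> K * norm x)"

definition weak_topology_on :: "'a::real_normed_vector set \<Rightarrow> 'a topology" where
  "weak_topology_on X = topology_generated_by
     {{x \<in> X. f x \<in> U} | f U. bounded_linear_functional_on X f \<and> open U}"

definition directed_set :: "'d set \<Rightarrow> ('d \<Rightarrow> 'd \<Rightarrow> bool) \<Rightarrow> bool" where
  "directed_set D le \<longleftrightarrow> D \<noteq> {} \<and> (\<forall>a\<in>D. le a a) \<and>
     (\<forall>a\<in>D. \<forall>b\<in>D. \<forall>c\<in>D. le a b \<longrightarrow> le b c \<longrightarrow> le a c) \<and>
     (\<forall>a\<in>D. \<forall>b\<in>D. \<exists>c\<in>D. le a c \<and> le b c)"

definition finite_rank :: "('a::real_normed_vector \<Rightarrow> 'b::real_normed_vector) \<Rightarrow> bool" where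
  "finite_rank P \<longleftrightarrow> bounded_linear P \<and> (\<exists>B. finite B \<and> range P \<subseteq> span B)"

definition is_EAB :: "real \<Rightarrow> 'd set \<Rightarrow> ('d \<Rightarrow> 'd \<Rightarrow> bool) \<Rightarrow> ('d \<Rightarrow> 'a::real_normed_vector \<Rightarrow> 'a) \<Rightarrow> bool" where
  "is_EAB lam D le P \<longleftrightarrow> lam \<ge> 1 \<and> directed_set D le \<and>
     (\<forall>\<alpha>\<in>D. finite_rank (P \<alpha>)) \<and>
     (\<forall>x. \<forall>\<epsilon>>0. \<exists>\<alpha>0\<in>D. \<forall>\<alpha>\<in>D. le \<alpha>0 \<alpha> \<longrightarrow> norm (P \<alpha> x - x) < \<epsilon>) \<and>
     (\<forall>\<alpha>\<in>D. onorm (P \<alpha>) \<le> lam)"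

definition cm_quantity :: "('a::real_normed_vector \<Rightarrow> 'a) \<Rightarrow> (nat \<Rightarrow> 'a) \<Rightarrow> 'a \<Rightarrow> nat \<Rightarrow> ereal" where
  "cm_quantity T u y n = limsup (\<lambda>i. ereal (Max ((\<lambda>A. norm (\<Sum>k\<in>A. T (u (i + k)) - T y)) ` Pow {1..n})))"

definition cm_nonexpansive :: "'a::real_normed_vector set \<Rightarrow> ('a \<Rightarrow> 'a) \<Rightarrow> bool" where
  "cm_nonexpansive C T \<longleftrightarrow> bounded C \<and> convex C \<and> T ` C \<subseteq> C \<and>
     (\<forall>x\<in>C. \<forall>y\<in>C. norm (T x - T y) \<le> norm (x - y)) \<and>
     (\<forall>n. \<forall>y\<in>C. \<forall>u. (\<forall>i. u i \<in> C) \<longrightarrow> cm_quantity T u y n \<le> cm_quantity id u y n)"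

definition weak_FPP_cm :: "'a::real_normed_vector set \<Rightarrow> bool" where
  "weak_FPP_cm X \<longleftrightarrow> (\<forall>C. C \<subseteq> X \<and> C \<noteq> {} \<and> convex C \<and> compactin (weak_topology_on X) C \<longrightarrow>
      (\<forall>T. cm_nonexpansive C T \<longrightarrow> (\<exists>x\<in>C. T x = x)))"

text \<open>Spreading models. The seminormed space E with sequence (e_i) is represented by
the seminorm N it induces on finitely supported coefficient sequences:
N a = |||sum_i a_i e_i|||.  Coefficient sequences are indexed from 0.\<close>

definition fin_supp :: "(nat \<Rightarrow> real) \<Rightarrow> bool" where
  "fin_supp a \<longleftrightarrow> finite {i. a i \<noteq> 0}"

definition seminorm_fs :: "((nat \<Rightarrow> real) \<Rightarrow> real) \<Rightarrow> bool" where
  "seminorm_fs N \<longleftrightarrow>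
     (\<forall>a. fin_supp a \<longrightarrow> N a \<ge> 0) \<and>
     (\<forall>a c. fin_supp a \<longrightarrow> N (\<lambda>i. c * a i) = \<bar>c\<bar> * N a) \<and>
     (\<forall>a b. fin_supp a \<longrightarrow> fin_supp b \<longrightarrow> N (\<lambda>i. a i + b i) \<le> N a + N b)"

definition generates_spreading_model ::
  "(nat \<Rightarrow> 'a::real_normed_vector) \<Rightarrow> (nat \<Rightarrow> nat) \<Rightarrow> ((nat \<Rightarrow> real) \<Rightarrow> real) \<Rightarrow> bool" where
  "generates_spreading_model x r N \<longleftrightarrow> strict_mono r \<and> seminorm_fs N \<and>
     (\<forall>n. \<forall>\<epsilon>>0. \<exists>n0. \<forall>\<kappa> a. strict_mono_on {..<n} \<kappa> \<and> (n > 0 \<longrightarrow> n0 \<le> \<kappa> 0) \<and>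
        (\<forall>i<n. \<bar>a i\<bar> \<le> 1) \<longrightarrow>
        \<bar>norm (\<Sum>i<n. a i *\<^sub>R x (r (\<kappa> i))) - N (\<lambda>i. if i < n then a i else 0)\<bar> < \<epsilon>)"

definition equivalent_to_l1_basis :: "((nat \<Rightarrow> real) \<Rightarrow> real) \<Rightarrow> bool" where
  "equivalent_to_l1_basis N \<longleftrightarrow> (\<exists>c K. c > 0 \<and>
     (\<forall>n a. c * (\<Sum>i<n. \<bar>a i\<bar>) \<le> N (\<lambda>i. if i < n then a i else 0) \<and>
            N (\<lambda>i. if i < n then a i else 0) \<le> K * (\<Sum>i<n. \<bar>a i\<bar>)))"

definition has_l1_spreading_model :: "'a::real_normed_vector set \<Rightarrow> bool" where
  "has_l1_spreading_model X \<longleftrightarrow> (\<exists>x r N. range x \<subseteq> X \<and> bounded (range x) \<and>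
     generates_spreading_model x r N \<and> equivalent_to_l1_basis N)"

end

theory Submission
  imports Defs "HOL-Library.Diagonal_Subsequence" "HOL-Library.Ramsey"
begin

text \<open>Let \<open>T\<close> be a fixed-point-free \<open>cm\<close>-nonexpansive map on a weakly compact convex set \<open>C\<close>, let
  \<open>w\<close> be an approximate fixed point sequence converging weakly to \<open>z \<in> C\<close>, and let \<open>N\<close> be the norm of
  a spreading model of \<open>w - z\<close>.  Since \<open>w - z\<close> is weakly null, \<open>N\<close> is suppression unconditional, so
  the supremum over \<open>A \<subseteq> {1..n}\<close> in the \<open>cm\<close> condition at \<open>y = z\<close> tends to \<open>N (e\<^sub>1 + \<dots> + e\<^sub>n)\<close>.
  As \<open>T w\<^sub>i - T z\<close> is close to \<open>(w\<^sub>i - z) + (z - T z)\<close>, this gives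
  \<open>n \<parallel>z - T z\<parallel> \<le> 2 N (e\<^sub>1 + \<dots> + e\<^sub>n)\<close>, and averaging over shifts together with unconditionality turns
  this into an \<open>\<ell>\<^sub>1\<close> lower estimate.\<close>

section \<open>Hahn--Banach separation\<close>

text \<open>The displacement \<open>z - T z\<close> enters all n summands with the same sign, so if
  it is nonzero it forces linear growth. Suppression unconditionality is what makes the right-hand
  side of the \<open>cm\<close> condition computable: no subset sum of \<open>w - z\<close>
  asymptotically exceeds the full sum. Two bounds by \<open>N (e_1 + ... + e_n)\<close> are added,
  one for the sum of \<open>T w_i - T z\<close> and one for the sum of \<open>w_i - z\<close>, hence
  the factor 2. Separating the signs of the coefficients costs another 2, so the final lower
  constant is \<open>norm (z - T z) / 4\<close>. The obstacle is that the spreading model is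
  extracted after the weak limit, by a further subsequence. The weak limit is therefore used in a
  form that survives this: \<open>z\<close> lies in the closed convex hull of every tail of every
  further subsequence. Unconditionality needs nothing else from weak convergence. Functionals serve
  only to obtain this form: separation yields weakly open half-spaces, and countably many norming
  functionals force the hull points of different subsequences to agree.\<close>

definition sublinear :: "('a::real_vector \<Rightarrow> real) \<Rightarrow> bool" where
  "sublinear p \<longleftrightarrow> (\<forall>x y. p (x + y) \<le> p x + p y) \<and> (\<forall>c x. 0 < c \<longrightarrow> p (c *\<^sub>R x) \<le> c * p x)"

lemma sublinear_add: "sublinear p \<Longrightarrow> p (x + y) \<le> p x + p y"
  by (simp add: sublinear_def)

lemma sublinear_zero:
  assumes "sublinear p"
  shows "p 0 = 0"
proof -
  have "p 0 \<le> p 0 + p 0" using sublinear_add[OF assms, of 0 0] by simp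
  moreover have "p ((1/2) *\<^sub>R 0) \<le> (1/2) * p 0"
    using assms unfolding sublinear_def by (meson half_gt_zero zero_less_one)
  ultimately show ?thesis by simp
qed

text \<open>The reverse inequality is the assumed one for \<open>inverse c\<close> at the scaled
  vector. The one-sided form of the definition is the one that passes directly to infima.\<close>

lemma sublinear_scale:
  assumes "sublinear p" "0 \<le> c"
  shows "p (c *\<^sub>R x) = c * p x"
proof (cases "c = 0")
  case True
  then show ?thesis using sublinear_zero[OF assms(1)] by simp
next
  case False
  then have c: "c > 0" using assms by simp
  have "p (inverse c *\<^sub>R (c *\<^sub>R x)) \<le> inverse c * p (c *\<^sub>R x)"
    using assms c unfolding sublinear_def by (meson positive_imp_inverse_positive)
  then have "c * p x \<le> p (c *\<^sub>R x)" using c by (simp add: field_simps)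
  moreover have "p (c *\<^sub>R x) \<le> c * p x" using assms c by (simp add: sublinear_def)
  ultimately show ?thesis by simp
qed

lemma sublinear_minus:
  assumes "sublinear p"
  shows "- p (- x) \<le> p x"
  using sublinear_add[OF assms, of x "- x"] sublinear_zero[OF assms] by simp

text \<open>The witness is the infimum of \<open>q (u + t s) - t \<delta>\<close> over t \<ge> 0 and
  s in S, the largest sublinear functional below \<open>q\<close> with the required values at
  \<open>- s\<close>. Every linear functional below it is at least \<delta> on S. The lemma serves
  twice: for a singleton in the minimality argument, and for a convex set in the separation.\<close>

lemma sublinear_lower:
  fixes q :: "'a::real_vector \<Rightarrow> real"
  assumes q: "sublinear q" and S: "convex S" "S \<noteq> {}" and \<delta>: "\<And>s. s \<in> S \<Longrightarrow> \<delta> \<le> q s"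
  obtains p where "sublinear p" "\<And>u. p u \<le> q u" "\<And>s. s \<in> S \<Longrightarrow> p (- s) \<le> - \<delta>"
proof -
  let ?I = "{0..} \<times> S :: (real \<times> 'a) set"
  define F where "F u z = q (u + fst z *\<^sub>R snd z) - fst z * \<delta>" for u and z :: "real \<times> 'a"
  define p where "p u = (INF z\<in>?I. F u z)" for u
  have ne: "?I \<noteq> {}" using S by auto
  \<comment> \<open>The infimum is finite because \<delta> \<le> q on S: subadditivity absorbs
    \<open>t *\<^sub>R s\<close> at the cost of \<open>q (- u)\<close>.\<close>
  have lb: "- q (- u) \<le> F u z" if zI: "z \<in> ?I" for u z
  proof -
    obtain t s where z: "z = (t, s)" "t \<ge> 0" "s \<in> S" using zI by auto
    have "t * \<delta> \<le> q (t *\<^sub>R s)"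
      using sublinear_scale[OF q] z \<delta>[OF z(3)] by (simp add: mult_left_mono)
    also have "\<dots> \<le> q (u + t *\<^sub>R s) + q (- u)"
      using sublinear_add[OF q, of "u + t *\<^sub>R s" "- u"] by simp
    finally show ?thesis by (simp add: F_def z)
  qed
  have bdd: "bdd_below (F u ` ?I)" for u
    using lb by (intro bdd_belowI2[where m = "- q (- u)"]) auto
  have le: "p u \<le> F u z" if "z \<in> ?I" for u z
    unfolding p_def by (rule cINF_lower[OF bdd that])
  have ge: "b \<le> p u" if "\<And>z. z \<in> ?I \<Longrightarrow> b \<le> F u z" for u b
    unfolding p_def by (rule cINF_greatest[OF ne]) (rule that)
  have add1: "p (u + v) \<le> F u z + F v w" if zw: "z \<in> ?I" "w \<in> ?I" for u v z w
  proof -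
    obtain t s where z: "z = (t, s)" "t \<ge> 0" "s \<in> S" using zw by auto
    obtain t' s' where w: "w = (t', s')" "t' \<ge> 0" "s' \<in> S" using zw by auto
    \<comment> \<open>Convexity enters here: the two multiples of points of S combine into
      \<open>t + t'\<close> times a single point of S. If both factors vanish, any point of S will
      do.\<close>
    obtain r where r: "r \<in> S" "(t + t') *\<^sub>R r = t *\<^sub>R s + t' *\<^sub>R s'"
    proof (cases "t + t' = 0")
      case True
      then have "t = 0" "t' = 0" using z w by auto
      then show ?thesis using that[of s] z by simp
    next
      case False
      have "(t / (t + t')) *\<^sub>R s + (t' / (t + t')) *\<^sub>R s' \<in> S"
        using z w False by (intro convexD[OF S(1)]) (auto simp: add_divide_distrib[symmetric])
      moreover have "(t + t') *\<^sub>R ((t / (t + t')) *\<^sub>R s + (t' / (t + t')) *\<^sub>R s') = t *\<^sub>R s + t' *\<^sub>R s'"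
        using False by (simp add: scaleR_right_distrib)
      ultimately show ?thesis using that by blast
    qed
    have "p (u + v) \<le> F (u + v) (t + t', r)" using z w r by (intro le) auto
    also have "\<dots> = q ((u + t *\<^sub>R s) + (v + t' *\<^sub>R s')) - (t + t') * \<delta>"
    proof -
      have "u + v + (t + t') *\<^sub>R r = (u + t *\<^sub>R s) + (v + t' *\<^sub>R s')" by (simp add: r(2))
      then show ?thesis by (simp only: F_def fst_conv snd_conv)
    qed
    also have "\<dots> \<le> F u z + F v w"
      using sublinear_add[OF q, of "u + t *\<^sub>R s" "v + t' *\<^sub>R s'"] by (simp add: F_def z w algebra_simps)
    finally show ?thesis .
  qed
  have add: "p (u + v) \<le> p u + p v" for u v
  proof -
    have "p (u + v) - p v \<le> F u z" if z: "z \<in> ?I" for z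
    proof -
      have "p (u + v) - F u z \<le> p v"
        by (rule ge) (use add1[OF z] in \<open>auto simp: algebra_simps\<close>)
      then show ?thesis by simp
    qed
    then have "p (u + v) - p v \<le> p u" by (rule ge)
    then show ?thesis by simp
  qed
  have scale: "p (c *\<^sub>R u) \<le> c * p u" if c: "0 < c" for c u
  proof -
    have "p (c *\<^sub>R u) / c \<le> F u z" if zI: "z \<in> ?I" for z
    proof -
      obtain t s where z: "z = (t, s)" "t \<ge> 0" "s \<in> S" using zI by auto
      have "p (c *\<^sub>R u) \<le> F (c *\<^sub>R u) (c * t, s)" using c z by (intro le) auto
      also have "\<dots> = q (c *\<^sub>R (u + t *\<^sub>R s)) - c * t * \<delta>" by (simp add: F_def algebra_simps)
      also have "\<dots> = c * q (u + t *\<^sub>R s) - c * t * \<delta>"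
        using c by (simp only: sublinear_scale[OF q less_imp_le[OF c]])
      also have "\<dots> = c * F u z" by (simp add: F_def z right_diff_distrib)
      finally show ?thesis using c by (simp add: field_simps)
    qed
    then have "p (c *\<^sub>R u) / c \<le> p u" by (rule ge)
    then show ?thesis using c by (simp add: field_simps)
  qed
  show thesis
  proof
    show "sublinear p" using add scale by (auto simp: sublinear_def)
    obtain s0 where "s0 \<in> S" using S by blast
    then show "p u \<le> q u" for u using le[of "(0, s0)" u] by (simp add: F_def)
    show "p (- s) \<le> - \<delta>" if "s \<in> S" for s
      using le[of "(1, s)" "- s"] that sublinear_zero[OF q] by (simp add: F_def)
  qed
qed

text \<open>Subadditivity survives the infimum because of the chain condition: the smaller of two
  members bounds both terms at once. The common majorant \<open>p\<close> keeps the infimum finite,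
  since each member is at least \<open>- p (- x)\<close> at x.\<close>

lemma sublinear_chain_INF:
  assumes ne: "\<C> \<noteq> {}" and sub: "\<And>q. q \<in> \<C> \<Longrightarrow> sublinear q \<and> (\<forall>x. q x \<le> p x)"
    and chain: "\<And>q r. q \<in> \<C> \<Longrightarrow> r \<in> \<C> \<Longrightarrow> q \<le> r \<or> r \<le> q"
  shows "sublinear (\<lambda>x. INF q\<in>\<C>. q x)" and "\<And>q x. q \<in> \<C> \<Longrightarrow> (INF q\<in>\<C>. q x) \<le> q x"
proof -
  define u where "u x = (INF q\<in>\<C>. q x)" for x
  have "- p (- x) \<le> q x" if "q \<in> \<C>" for q x
  proof -
    have "q (- x) \<le> p (- x)" using sub[OF that] by blast
    then show ?thesis using sub[OF that] sublinear_minus[of q x] by linarith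
  qed
  then have bdd: "bdd_below ((\<lambda>q. q x) ` \<C>)" for x
    by (intro bdd_belowI2[where m = "- p (- x)"])
  have le: "u x \<le> q x" if "q \<in> \<C>" for q x
    unfolding u_def by (rule cINF_lower[OF bdd that])
  have ge: "b \<le> u x" if "\<And>q. q \<in> \<C> \<Longrightarrow> b \<le> q x" for x b
    unfolding u_def by (rule cINF_greatest[OF ne]) (rule that)
  have add1: "u (x + y) \<le> q x + r y" if qr: "q \<in> \<C>" "r \<in> \<C>" for x y q r
  proof -
    obtain s where s: "s \<in> \<C>" "s \<le> q" "s \<le> r" using chain[OF qr] qr by blast
    have "u (x + y) \<le> s x + s y"
      using le[OF s(1), of "x + y"] sublinear_add[of s x y] sub[OF s(1)] by linarith
    also have "\<dots> \<le> q x + r y" using s by (intro add_mono) (auto simp: le_fun_def)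
    finally show ?thesis .
  qed
  have "u (x + y) \<le> u x + u y" for x y
  proof -
    have "u (x + y) - u y \<le> q x" if q: "q \<in> \<C>" for q
    proof -
      have "u (x + y) - q x \<le> u y" by (rule ge) (use add1[OF q] in \<open>auto simp: algebra_simps\<close>)
      then show ?thesis by simp
    qed
    then have "u (x + y) - u y \<le> u x" by (rule ge)
    then show ?thesis by simp
  qed
  moreover have "u (c *\<^sub>R x) \<le> c * u x" if c: "0 < c" for c x
  proof -
    have "u (c *\<^sub>R x) / c \<le> q x" if q: "q \<in> \<C>" for q
    proof -
      have "u (c *\<^sub>R x) \<le> c * q x"
        using le[OF q, of "c *\<^sub>R x"] sublinear_scale[of q c x] sub[OF q] c by simp
      then show ?thesis using c by (simp add: field_simps)
    qed
    then have "u (c *\<^sub>R x) / c \<le> u x" by (rule ge)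
    then show ?thesis using c by (simp add: field_simps)
  qed
  ultimately show "sublinear (\<lambda>x. INF q\<in>\<C>. q x)"
    unfolding sublinear_def u_def by blast
  show "\<And>q x. q \<in> \<C> \<Longrightarrow> (INF q\<in>\<C>. q x) \<le> q x" using le unfolding u_def .
qed

text \<open>A pointwise minimal sublinear functional is linear.\<close>

lemma linear_below_sublinear:
  fixes p :: "'a::real_vector \<Rightarrow> real"
  assumes "sublinear p"
  obtains f where "linear f" "\<And>x. f x \<le> p x"
proof -
  define \<A> where "\<A> = {q. sublinear q \<and> (\<forall>x. q x \<le> p x)}"
  \<comment> \<open>Zorn is applied to the reversed order: bounds of chains are pointwise infima,
    and the maximal element is a minimal functional.\<close>
  let ?ge = "\<lambda>q r :: 'a \<Rightarrow> real. r \<le> q"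
  have "\<exists>m\<in>\<A>. \<forall>a\<in>\<A>. a \<le> m \<longrightarrow> a = m"
  proof (rule predicate_Zorn[of \<A> ?ge])
    show "partial_order_on \<A> (relation_of ?ge \<A>)"
      by (rule partial_order_on_relation_ofI) auto
    fix \<C> assume "\<C> \<in> Chains (relation_of ?ge \<A>)"
    then have C: "\<C> \<subseteq> \<A>" "\<And>q r. q \<in> \<C> \<Longrightarrow> r \<in> \<C> \<Longrightarrow> q \<le> r \<or> r \<le> q"
      by (auto simp: Chains_def relation_of_def)
    show "\<exists>u\<in>\<A>. \<forall>a\<in>\<C>. u \<le> a"
    proof (cases "\<C> = {}")
      case True
      then show ?thesis using assms by (auto simp: \<A>_def)
    next
      case False
      note inf = sublinear_chain_INF[OF False, of p]
      have s: "sublinear (\<lambda>x. INF q\<in>\<C>. q x)" using C by (intro inf) (auto simp: \<A>_def)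
      have l: "(INF q\<in>\<C>. q x) \<le> q x" if "q \<in> \<C>" for q x
        using C that by (intro inf) (auto simp: \<A>_def)
      obtain q0 where q0: "q0 \<in> \<C>" using False by blast
      have "q0 \<in> \<A>" using C(1) q0 by blast
      then have "q0 x \<le> p x" for x by (simp add: \<A>_def)
      then have "(INF q\<in>\<C>. q x) \<le> p x" for x
        by (rule order_trans[OF l[OF q0]])
      then show ?thesis using s l
        by (intro bexI[of _ "\<lambda>x. INF q\<in>\<C>. q x"]) (auto simp: \<A>_def le_fun_def)
    qed
  qed
  then obtain q where "q \<in> \<A>" and qmin: "\<forall>a\<in>\<A>. a \<le> q \<longrightarrow> a = q" by blast
  then have q: "sublinear q" "\<And>x. q x \<le> p x" by (auto simp: \<A>_def)
  have min: "r = q" if r: "sublinear r" "\<And>x. r x \<le> q x" for r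
  proof -
    have "r x \<le> p x" for x by (rule order_trans[OF r(2) q(2)])
    then show ?thesis using qmin r by (simp add: \<A>_def le_fun_def)
  qed
  \<comment> \<open>Lowering \<open>q\<close> so that its value at \<open>- v\<close> is at most
    \<open>- q v\<close> gives a sublinear functional below \<open>q\<close>, which by minimality is
    \<open>q\<close> itself.\<close>
  have odd: "q (- v) = - q v" for v
  proof -
    obtain r where r: "sublinear r" "\<And>u. r u \<le> q u" "\<And>s. s \<in> {v} \<Longrightarrow> r (- s) \<le> - q v"
      by (rule sublinear_lower[OF q(1), of "{v}" "q v"]) auto
    have "q (- v) \<le> - q v" using min[OF r(1,2)] r(3)[of v] by simp
    then show ?thesis using sublinear_minus[OF q(1), of v] by simp
  qed
  have "linear q"
  proof (rule linearI)
    fix x y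
    show "q (x + y) = q x + q y"
      using sublinear_add[OF q(1), of x y] sublinear_add[OF q(1), of "- x" "- y"]
        odd[of x] odd[of y] odd[of "x + y"] by simp
  next
    fix c x
    show "q (c *\<^sub>R x) = c *\<^sub>R q x"
      using sublinear_scale[OF q(1), of c x] sublinear_scale[OF q(1), of "- c" x] odd[of "c *\<^sub>R x"]
      by (cases "c \<ge> 0") auto
  qed
  then show thesis using that q by blast
qed

text \<open>The lowering construction is applied to the norm. Domination by the norm at both v and
  \<open>- v\<close> gives the bound on the absolute value, and the values of \<open>p\<close> at
  \<open>- s\<close> give the lower bound on S.\<close>

lemma separating_functional:
  fixes S :: "'a::real_normed_vector set"
  assumes "convex S" "S \<noteq> {}" and "\<And>s. s \<in> S \<Longrightarrow> \<delta> \<le> norm s"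
  obtains f where "linear f" "\<And>v. \<bar>f v\<bar> \<le> norm v" "\<And>s. s \<in> S \<Longrightarrow> \<delta> \<le> f s"
proof -
  have "sublinear (norm :: 'a \<Rightarrow> real)" by (auto simp: sublinear_def norm_triangle_ineq)
  from sublinear_lower[OF this assms] obtain p
    where p: "sublinear p" "\<And>u. p u \<le> norm u" "\<And>s. s \<in> S \<Longrightarrow> p (- s) \<le> - \<delta>"
    by blast
  obtain f where f: "linear f" "\<And>x. f x \<le> p x" using linear_below_sublinear[OF p(1)] by blast
  have "\<bar>f v\<bar> \<le> norm v" for v
    using f(2)[of v] f(2)[of "- v"] p(2)[of v] p(2)[of "- v"] linear_neg[OF f(1), of v] by simp
  moreover have "\<delta> \<le> f s" if "s \<in> S" for s
    using f(2)[of "- s"] p(3)[OF that] linear_neg[OF f(1), of s] by simp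
  ultimately show thesis using that f(1) by blast
qed

section \<open>Weakly compact sets\<close>

lemma openin_weak_topology_on:
  assumes "linear f" "\<And>v. \<bar>f v\<bar> \<le> norm v" "open U"
  shows "openin (weak_topology_on X) {x \<in> X. f x \<in> U}"
proof -
  have "bounded_linear_functional_on X f"
    unfolding bounded_linear_functional_on_def
    using assms linear_add[OF assms(1)] linear_scale[OF assms(1)] by (auto intro!: exI[of _ 1])
  then show ?thesis
    unfolding weak_topology_on_def openin_topology_generated_by_iff
    using assms(3) by (auto intro!: generate_topology_on.Basis)
qed

lemma compactin_weak_topology_on_subset:
  assumes "compactin (weak_topology_on X) C"
  shows "C \<subseteq> X"
  using compactin_subset_topspace[OF assms]
  unfolding weak_topology_on_def topology_generated_by_topspace by auto

text \<open>Substitute for the Eberlein--Smulian theorem: a point in the closed convex hulls of all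
  tails takes the place of a weak limit.\<close>

lemma weakly_compact_tail_hulls:
  fixes C :: "'a::real_normed_vector set" and x :: "nat \<Rightarrow> 'a"
  assumes C: "compactin (weak_topology_on X) C" and x: "range x \<subseteq> C"
  shows "\<exists>z\<in>C. \<forall>K. z \<in> closure (convex hull (x ` {K..}))"
proof (rule ccontr)
  assume "\<not> ?thesis"
  then have *: "\<exists>K. z \<notin> closure (convex hull (x ` {K..}))" if "z \<in> C" for z
    using that by blast
  \<comment> \<open>These are the weakly open sets that the sequence eventually avoids. Finitely
    many of them cannot cover C, because some term of the sequence avoids them all.\<close>
  define \<U> where "\<U> = {U. openin (weak_topology_on X) U \<and> (\<forall>\<^sub>F n in sequentially. x n \<notin> U)}"
  have "C \<subseteq> \<Union>\<U>"
  proof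
    fix z assume z: "z \<in> C"
    then have "z \<in> X" using compactin_weak_topology_on_subset[OF C] by blast
    obtain K where "z \<notin> closure (convex hull (x ` {K..}))" using *[OF z] by blast
    then have "\<exists>\<delta>>0. \<forall>s\<in>convex hull (x ` {K..}). \<delta> \<le> dist s z"
      by (simp add: closure_approachable not_less)
    then obtain \<delta> where \<delta>: "\<delta> > 0" "\<And>s. s \<in> convex hull (x ` {K..}) \<Longrightarrow> \<delta> \<le> dist s z"
      by blast
    \<comment> \<open>The tail hull is moved by \<open>- z\<close> so that its distance from z
      becomes a lower bound on norms. The functional then yields a weakly open half-space that
      contains z and misses the tail.\<close>
    let ?S = "(\<lambda>s. s - z) ` (convex hull (x ` {K..}))"
    have S1: "convex ?S" by (intro convex_translation_subtract convex_convex_hull)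
    have S2: "?S \<noteq> {}" by simp
    have S3: "\<delta> \<le> norm s" if "s \<in> ?S" for s using that \<delta>(2) by (auto simp: dist_norm)
    obtain f where f: "linear f" "\<And>v. \<bar>f v\<bar> \<le> norm v" "\<And>s. s \<in> ?S \<Longrightarrow> \<delta> \<le> f s"
      using separating_functional[OF S1 S2 S3] by blast
    have "f z + \<delta> \<le> f (x n)" if "n \<ge> K" for n
    proof -
      have "x n - z \<in> ?S" using that by (intro imageI hull_inc) auto
      from f(3)[OF this] show ?thesis by (simp add: linear_diff[OF f(1)])
    qed
    then have "\<forall>\<^sub>F n in sequentially. x n \<notin> {v \<in> X. f v \<in> {..<f z + \<delta>}}"
      by (intro eventually_sequentiallyI[of K]) (force simp: not_less)
    then have "{v \<in> X. f v \<in> {..<f z + \<delta>}} \<in> \<U>"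
      unfolding \<U>_def using openin_weak_topology_on[OF f(1,2), of "{..<f z + \<delta>}" X] by simp
    moreover have "z \<in> {v \<in> X. f v \<in> {..<f z + \<delta>}}" using \<open>z \<in> X\<close> \<delta> by simp
    ultimately show "z \<in> \<Union>\<U>" by blast
  qed
  moreover have "\<forall>U\<in>\<U>. openin (weak_topology_on X) U" by (simp add: \<U>_def)
  moreover have "\<forall>\<V>. (\<forall>U\<in>\<V>. openin (weak_topology_on X) U) \<and> C \<subseteq> \<Union>\<V> \<longrightarrow>
      (\<exists>F. finite F \<and> F \<subseteq> \<V> \<and> C \<subseteq> \<Union>F)"
    using C unfolding compactin_def by blast
  ultimately have "\<exists>F. finite F \<and> F \<subseteq> \<U> \<and> C \<subseteq> \<Union>F" by simp
  then obtain F where F: "finite F" "F \<subseteq> \<U>" "C \<subseteq> \<Union>F" by blast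
  have "\<forall>\<^sub>F n in sequentially. \<forall>U\<in>F. x n \<notin> U"
    using F by (intro eventually_ball_finite) (auto simp: \<U>_def)
  from eventually_happens'[OF sequentially_bot this] obtain n where "\<forall>U\<in>F. x n \<notin> U" ..
  then show False using F(3) x by blast
qed

text \<open>This plays the role of the weak closedness of closed convex sets, and transfers balls
  and preimages of balls under functionals from the sequence to the hull point.\<close>

lemma tail_hulls_mem:
  assumes "\<And>K. z \<in> closure (convex hull (x ` {K::nat..}))"
    and "closed S" "convex S" "\<forall>\<^sub>F n in sequentially. x n \<in> S"
  shows "z \<in> S"
proof -
  obtain K where "\<forall>n\<ge>K. x n \<in> S" using assms(4) by (auto simp: eventually_sequentially)
  then have "closure (convex hull (x ` {K..})) \<subseteq> S"
    using assms(2,3) by (intro closure_minimal hull_minimal) auto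
  then show ?thesis using assms(1) by blast
qed

text \<open>Closed balls around the norm limit are convex and contain a tail, so the hull point
  supplied by compactness is the norm limit. Closedness gives the completeness needed for the
  contraction principle.\<close>

lemma weakly_compact_imp_closed:
  fixes C :: "'a::real_normed_vector set"
  assumes C: "compactin (weak_topology_on X) C"
  shows "closed C"
  unfolding closed_sequential_limits
proof (intro allI impI, elim conjE)
  fix x :: "nat \<Rightarrow> 'a" and l assume x: "\<forall>n. x n \<in> C" "x \<longlonglongrightarrow> l"
  then have "range x \<subseteq> C" by blast
  then obtain z where z: "z \<in> C" "\<And>K. z \<in> closure (convex hull (x ` {K..}))"
    using weakly_compact_tail_hulls[OF C] by blast
  have "dist l z \<le> e" if "e > 0" for e
  proof -
    have "\<forall>\<^sub>F n in sequentially. x n \<in> cball l e"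
      using tendstoD[OF x(2) that] by eventually_elim (simp add: dist_commute)
    then have "z \<in> cball l e" by (intro tail_hulls_mem[OF z(2)]) auto
    then show ?thesis by simp
  qed
  then have "dist l z \<le> 0" by (meson dense_ge)
  then show "l \<in> C" using z by simp
qed

section \<open>Approximate fixed points of nonexpansive maps\<close>

lemma approximate_fixed_points:
  fixes C :: "'a::banach set"
  assumes C: "closed C" "convex C" "bounded C" "C \<noteq> {}" and T: "T ` C \<subseteq> C"
    and ne: "\<And>x y. x \<in> C \<Longrightarrow> y \<in> C \<Longrightarrow> norm (T x - T y) \<le> norm (x - y)"
  obtains u where "range u \<subseteq> C" "(\<lambda>n::nat. norm (T (u n) - u n)) \<longlonglongrightarrow> 0"
proof -
  obtain x0 where x0: "x0 \<in> C" using C by blast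
  obtain B where B: "\<And>x. x \<in> C \<Longrightarrow> norm x \<le> B" using C by (auto simp: bounded_iff)
  have ex: "\<exists>u\<in>C. norm (T u - u) \<le> inverse (real (Suc n)) * (2 * B)" for n
  proof -
    \<comment> \<open>Mixing \<open>T\<close> with the constant \<open>x0\<close> at weight t gives
      a contraction with constant \<open>1 - t\<close>; the value t = 1 at n = 0 is harmless, the
      constant then being 0. At its fixed point the displacement is
      \<open>t *\<^sub>R (T u - x0)\<close>, of norm at most \<open>t * (2 * B)\<close>.\<close>
    define t where "t = inverse (real (Suc n))"
    have t: "0 < t" "t \<le> 1" by (auto simp: t_def field_simps)
    have "\<exists>!u\<in>C. (1 - t) *\<^sub>R T u + t *\<^sub>R x0 = u"
    proof (rule Banach_fix[of C "1 - t"])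
      show "complete C" using C by (simp add: complete_eq_closed)
      show "(\<lambda>u. (1 - t) *\<^sub>R T u + t *\<^sub>R x0) ` C \<subseteq> C"
        using T x0 t by (auto intro!: convexD[OF C(2)])
      fix x y assume xy: "x \<in> C" "y \<in> C"
      have "dist ((1 - t) *\<^sub>R T x + t *\<^sub>R x0) ((1 - t) *\<^sub>R T y + t *\<^sub>R x0) = norm ((1 - t) *\<^sub>R (T x - T y))"
        by (simp add: dist_norm scaleR_diff_right)
      also have "\<dots> = (1 - t) * norm (T x - T y)" using t by simp
      also have "\<dots> \<le> (1 - t) * dist x y" using t ne xy by (auto simp: dist_norm intro!: mult_left_mono)
      finally show "dist ((1 - t) *\<^sub>R T x + t *\<^sub>R x0) ((1 - t) *\<^sub>R T y + t *\<^sub>R x0) \<le> (1 - t) * dist x y" .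
    qed (use t C in auto)
    then obtain u where u: "u \<in> C" "(1 - t) *\<^sub>R T u + t *\<^sub>R x0 = u" by blast
    have "T u - u = T u - ((1 - t) *\<^sub>R T u + t *\<^sub>R x0)" by (simp only: u(2))
    also have "\<dots> = t *\<^sub>R (T u - x0)" by (simp add: algebra_simps)
    finally have "norm (T u - u) = t * norm (T u - x0)" using t by simp
    also have "\<dots> \<le> t * (2 * B)"
    proof (rule mult_left_mono)
      have "T u \<in> C" using T u(1) by blast
      then show "norm (T u - x0) \<le> 2 * B"
        using norm_triangle_ineq4[of "T u" x0] B[OF x0] B[of "T u"] by linarith
    qed (use t in simp)
    finally show ?thesis using u(1) unfolding t_def by blast
  qed
  then have "\<forall>n. \<exists>v. v \<in> C \<and> norm (T v - v) \<le> inverse (real (Suc n)) * (2 * B)" by blast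
  from choice[OF this] obtain u
    where u: "\<And>n. u n \<in> C" "\<And>n. norm (T (u n) - u n) \<le> inverse (real (Suc n)) * (2 * B)"
    by blast
  have "(\<lambda>n. inverse (real (Suc n)) * (2 * B)) \<longlonglongrightarrow> 0"
    by (intro tendsto_mult_left_zero LIMSEQ_inverse_real_of_nat)
  then have "(\<lambda>n. norm (T (u n) - u n)) \<longlonglongrightarrow> 0"
    by (rule tendsto_sandwich[OF _ _ tendsto_const, rotated 2]) (use u in auto)
  then show thesis using that u by blast
qed

section \<open>Subsequences with a stable weak limit\<close>

lemma countable_separating_functionals:
  fixes x :: "nat \<Rightarrow> 'a::real_normed_vector"
  obtains f :: "nat \<Rightarrow> 'a \<Rightarrow> real" where "\<And>j. linear (f j)" "\<And>j v. \<bar>f j v\<bar> \<le> norm v"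
    "\<And>v. v \<in> closure (span (range x)) \<Longrightarrow> (\<And>j. f j v = 0) \<Longrightarrow> v = 0"
proof -
  \<comment> \<open>Lists of rational coefficients and indices code a countable dense subset of the
    span.\<close>
  define g where "g l = (\<Sum>(q, n)\<leftarrow>l. real_of_rat q *\<^sub>R x n)" for l :: "(rat \<times> nat) list"
  have sub: "span (range x) \<subseteq> closure (range g)"
  proof
    fix v assume "v \<in> span (range x)"
    then show "v \<in> closure (range g)"
    proof (induction v rule: span_induct_alt)
      case base
      have "g [] = 0" by (simp add: g_def)
      then show ?case by (metis closure_subset rangeI subsetD)
    next
      case (step c w y)
      then obtain n where n: "w = x n" by blast
      show ?case unfolding closure_approachable
      proof (intro allI impI)
        fix e :: real assume e: "e > 0"
        obtain l where l: "dist (g l) y < e / 2"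
          using step e unfolding closure_approachable by (metis half_gt_zero imageE)
        define p where "p = norm w + 1"
        have p: "p > 0" by (simp add: p_def add_nonneg_pos)
        define d where "d = e / (2 * p)"
        have d: "d > 0" using e p by (simp add: d_def)
        obtain q where q: "c < real_of_rat q" "real_of_rat q < c + d"
          using of_rat_dense[of c "c + d"] d by auto
        have "norm w * d \<le> p * d" using d by (simp add: p_def)
        also have "\<dots> = e / 2" using p by (simp add: d_def)
        finally have *: "norm w * d \<le> e / 2" .
        have "\<bar>real_of_rat q - c\<bar> * norm w \<le> d * norm w" using q by (intro mult_right_mono) auto
        with * have q': "norm ((real_of_rat q - c) *\<^sub>R w) \<le> e / 2" by (simp add: mult.commute)
        have "g ((q, n) # l) - (c *\<^sub>R w + y) = (real_of_rat q - c) *\<^sub>R w + (g l - y)"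
          by (simp add: g_def n algebra_simps)
        then have "dist (g ((q, n) # l)) (c *\<^sub>R w + y) \<le> norm ((real_of_rat q - c) *\<^sub>R w) + dist (g l) y"
          by (metis dist_norm norm_triangle_ineq)
        also have "\<dots> < e" using q' l by simp
        finally show "\<exists>z\<in>range g. dist z (c *\<^sub>R w + y) < e" by blast
      qed
    qed
  qed
  have "\<exists>f. linear f \<and> (\<forall>v. \<bar>f v\<bar> \<le> norm v) \<and> norm w \<le> f w" for w :: 'a
    by (rule separating_functional[of "{w}" "norm w"]) auto
  then obtain F where F: "\<And>w. linear (F w)" "\<And>w v. \<bar>F w v\<bar> \<le> norm v" "\<And>w. norm w \<le> F w (w :: 'a)"
    by metis
  \<comment> \<open>Norming functionals of a dense set separate points: if the functional of w
    vanishes at v, then \<open>norm w\<close> is at most its value at \<open>w - v\<close>, hence at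
    most the distance from w to v. Points w close to v thus force v = 0.\<close>
  define f where "f j = F (g (from_nat j))" for j
  show thesis
  proof
    show "linear (f j)" "\<bar>f j v\<bar> \<le> norm v" for j v using F by (auto simp: f_def)
    fix v assume v: "v \<in> closure (span (range x))" and f0: "\<And>j. f j v = 0"
    have "closure (span (range x)) \<subseteq> closure (range g)" using sub by (simp add: closure_minimal)
    then have v: "v \<in> closure (range g)" using v by blast
    have "norm v \<le> e" if e: "e > 0" for e
    proof -
      obtain l where l: "dist (g l) v < e / 2"
        using v e unfolding closure_approachable by (metis half_gt_zero imageE)
      have "f (to_nat l) v = 0" by (rule f0)
      then have "F (g l) v = 0" by (simp add: f_def)
      then have "F (g l) (g l) = F (g l) (g l - v)" by (simp add: linear_diff[OF F(1)])
      then have "norm (g l) \<le> norm (g l - v)" using F(3)[of "g l"] F(2)[of "g l" "g l - v"] by linarith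
      then show ?thesis using l norm_triangle_ineq2[of v "g l"] by (simp add: dist_norm norm_minus_commute)
    qed
    then have "norm v \<le> 0" by (meson dense_ge)
    then show "v = 0" by simp
  qed
qed

lemma diagonal_convergent_subsequence:
  fixes h :: "nat \<Rightarrow> nat \<Rightarrow> real"
  assumes "\<And>j. bounded (range (h j))"
  obtains s where "strict_mono s" "\<And>j. convergent (\<lambda>n. h j (s n))"
proof -
  interpret subseqs "\<lambda>j s. convergent (\<lambda>n. h j (s n))"
  proof
    fix j and s :: "nat \<Rightarrow> nat" assume "strict_mono s"
    have "bounded (range (h j \<circ> s))" by (rule bounded_subset[OF assms[of j]]) auto
    then obtain l r where "strict_mono r" "((h j \<circ> s) \<circ> r) \<longlonglongrightarrow> l"
      using bounded_imp_convergent_subsequence by blast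
    then show "\<exists>r. strict_mono r \<and> convergent (\<lambda>n. h j ((s \<circ> r) n))"
      by (auto simp: convergent_def o_def)
  qed
  \<comment> \<open>The diagonal sequence is guaranteed to refine the j-th extraction only after its
    first \<open>Suc j\<close> terms, which do not affect convergence.\<close>
  have "convergent (\<lambda>n. h j ((diagseq \<circ> (+) (Suc j)) n))" for j
    by (rule diagseq_holds)
      (use convergent_subseq_convergent in \<open>fastforce simp: o_def\<close>)
  note conv = this
  have "convergent (\<lambda>n. h j (diagseq (n + Suc j)))" for j
    using conv[of j] by (simp add: o_def add.commute)
  then have "convergent (\<lambda>n. h j (diagseq n))" for j
    using convergent_ignore_initial_segment[of "\<lambda>n. h j (diagseq n)" "Suc j"] by simp
  then show thesis using that subseq_diagseq by blast
qed

lemma diff_mem_closure_subspace: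
  fixes V :: "'a::real_normed_vector set"
  assumes V: "subspace V" and "v \<in> closure V" "w \<in> closure V"
  shows "v - w \<in> closure V"
proof -
  obtain a b where a: "\<And>n. a n \<in> V" "a \<longlonglongrightarrow> v" and b: "\<And>n. b n \<in> V" "b \<longlonglongrightarrow> w"
    using assms unfolding closure_sequential by blast
  have "(\<lambda>n. a n - b n) \<longlonglongrightarrow> v - w" using a b by (intro tendsto_diff)
  moreover have "a n - b n \<in> V" for n using a b by (intro subspace_diff[OF V])
  ultimately show ?thesis unfolding closure_sequential by (intro exI[of _ "\<lambda>n. a n - b n"]) auto
qed

text \<open>The quantifier over \<open>r\<close> provides for the later extraction of a spreading
  model. Along \<open>s\<close> all the separating functionals converge, so the hull points of any
  two further subsequences take equal values under them. As these points lie in the closed span of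
  the sequence, they coincide.\<close>

lemma weakly_compact_subsequence_tail_hulls:
  fixes C :: "'a::real_normed_vector set" and u :: "nat \<Rightarrow> 'a"
  assumes C: "compactin (weak_topology_on X) C" "bounded C" and u: "range u \<subseteq> C"
  obtains s :: "nat \<Rightarrow> nat" and z where "strict_mono s" "z \<in> C"
    "\<And>r K. strict_mono r \<Longrightarrow> z \<in> closure (convex hull ((\<lambda>n. u (s (r n))) ` {K::nat..}))"
proof -
  obtain B where B: "\<And>x. x \<in> C \<Longrightarrow> norm x \<le> B" using C by (auto simp: bounded_iff)
  obtain f :: "nat \<Rightarrow> 'a \<Rightarrow> real" where f: "\<And>j. linear (f j)" "\<And>j v. \<bar>f j v\<bar> \<le> norm v"
    "\<And>v. v \<in> closure (span (range u)) \<Longrightarrow> (\<And>j. f j v = 0) \<Longrightarrow> v = 0"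
    using countable_separating_functionals[of u] by blast
  have "u n \<in> C" for n using u by blast
  then have "\<bar>f j (u n)\<bar> \<le> B" for j n by (rule order_trans[OF f(2) B])
  then have "bounded (range (\<lambda>n. f j (u n)))" for j
    unfolding bounded_iff by (intro exI[of _ B]) auto
  then obtain s where s: "strict_mono s" "\<And>j. convergent (\<lambda>n. f j (u (s n)))"
    using diagonal_convergent_subsequence[of "\<lambda>j n. f j (u n)"] by blast
  then obtain L where L: "\<And>j. (\<lambda>n. f j (u (s n))) \<longlonglongrightarrow> L j" unfolding convergent_def by metis
  have eq: "f j w = L j" if r: "strict_mono r"
    and w: "\<And>K. w \<in> closure (convex hull ((\<lambda>n. u (s (r n))) ` {K::nat..}))" for j w r
  proof -
    have lim: "(\<lambda>n. f j (u (s (r n)))) \<longlonglongrightarrow> L j" using LIMSEQ_subseq_LIMSEQ[OF L r] by (simp add: o_def)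
    have bl: "bounded_linear (f j)" using f(1,2) by (auto simp: bounded_linear_def bounded_linear_axioms_def intro!: exI[of _ 1])
    have "dist (L j) (f j w) \<le> e" if e: "e > 0" for e
    proof -
      have "w \<in> f j -` cball (L j) e"
      proof (rule tail_hulls_mem[OF w])
        show "closed (f j -` cball (L j) e)"
          by (intro closed_vimage linear_continuous_on bl closed_cball)
        show "convex (f j -` cball (L j) e)" by (intro convex_linear_vimage f convex_cball)
        show "\<forall>\<^sub>F n in sequentially. u (s (r n)) \<in> f j -` cball (L j) e"
          using tendstoD[OF lim e] by eventually_elim (simp add: dist_commute)
      qed
      then show ?thesis by simp
    qed
    then have "dist (L j) (f j w) \<le> 0" by (meson dense_ge)
    then show ?thesis by simp
  qed
  have hull: "w \<in> closure (span (range u))"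
    if "w \<in> closure (convex hull ((\<lambda>n. u (s (r n))) ` {0::nat..}))" for w and r :: "nat \<Rightarrow> nat"
  proof -
    have "convex hull ((\<lambda>n. u (s (r n))) ` {0..}) \<subseteq> convex hull (range u)"
      by (intro hull_mono) auto
    also have "\<dots> \<subseteq> span (range u)" by (rule convex_hull_subset_span)
    finally show ?thesis using that closure_mono by blast
  qed
  have ex: "\<exists>w. w \<in> C \<and> (\<forall>K. w \<in> closure (convex hull ((\<lambda>n. u (s (r n))) ` {K::nat..})))" for r :: "nat \<Rightarrow> nat"
  proof -
    have "range (\<lambda>n. u (s (r n))) \<subseteq> C" using u by blast
    from weakly_compact_tail_hulls[OF C(1) this] show ?thesis by blast
  qed
  from ex[of id] obtain z
    where "z \<in> C \<and> (\<forall>K. z \<in> closure (convex hull ((\<lambda>n. u (s (id n))) ` {K::nat..})))" ..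
  note z = conjunct1[OF this] spec[OF conjunct2[OF this]]
  have "z \<in> closure (convex hull ((\<lambda>n. u (s (r n))) ` {K..}))" if r: "strict_mono r" for r and K :: nat
  proof -
    from ex[of r] obtain w
      where "w \<in> C \<and> (\<forall>K. w \<in> closure (convex hull ((\<lambda>n. u (s (r n))) ` {K::nat..})))" ..
    note w = conjunct1[OF this] spec[OF conjunct2[OF this]]
    have "z - w = 0"
    proof (rule f(3))
      have "z \<in> closure (span (range u))" by (rule hull[where r = id]) (rule z(2))
      moreover have "w \<in> closure (span (range u))" by (rule hull[where r = r]) (rule w(2))
      ultimately show "z - w \<in> closure (span (range u))"
        by (rule diff_mem_closure_subspace[OF subspace_span])
      have id: "strict_mono (id :: nat \<Rightarrow> nat)" by (simp add: strict_mono_def)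
      show "f j (z - w) = 0" for j
        using eq[where r = id and w = z and j = j, OF id z(2)] eq[where r = r and w = w and j = j, OF r w(2)]
        by (simp add: linear_diff[OF f(1)])
    qed
    then show ?thesis using w(2) by simp
  qed
  note mem = this
  show thesis by (rule that[OF s(1) z(1)]) (rule mem)
qed

section \<open>Brunel--Sucheston extraction\<close>

text \<open>The definition of a spreading model constrains only the first n indices, while the
  extraction works with total strictly increasing sequences. Adding the sum of all given indices
  pushes the new values beyond each of them.\<close>

lemma strict_mono_extension:
  fixes \<kappa> :: "nat \<Rightarrow> nat"
  assumes "strict_mono_on {..<n} \<kappa>"
  obtains \<kappa>' where "strict_mono \<kappa>'" "\<And>i. i < n \<Longrightarrow> \<kappa>' i = \<kappa> i"
proof
  let ?k = "\<lambda>i. if i < n then \<kappa> i else (\<Sum>j<n. \<kappa> j) + i + 1"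
  have le: "\<kappa> i \<le> (\<Sum>j<n. \<kappa> j)" if "i < n" for i using that by (intro member_le_sum) auto
  have "?k i < ?k (Suc i)" for i
  proof (cases "Suc i < n")
    case True
    then show ?thesis using assms by (auto simp: strict_mono_on_def)
  next
    case False
    then show ?thesis using le[of i] by auto
  qed
  then show "strict_mono ?k" by (simp add: strict_mono_Suc_iff)
qed auto

lemma Ramsey_norm_sum:
  fixes x :: "nat \<Rightarrow> 'a::real_normed_vector" and a :: "nat \<Rightarrow> real" and n :: nat
  assumes x: "bounded (range x)" and \<epsilon>: "\<epsilon> > 0"
  shows "\<exists>r :: nat \<Rightarrow> nat. strict_mono r \<and> (\<forall>\<kappa> \<kappa>'. strict_mono \<kappa> \<longrightarrow> strict_mono \<kappa>' \<longrightarrow>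
     \<bar>norm (\<Sum>i<n. a i *\<^sub>R x (r (\<kappa> i))) - norm (\<Sum>i<n. a i *\<^sub>R x (r (\<kappa>' i)))\<bar> \<le> \<epsilon>)"
proof -
  obtain B where B: "\<And>i. norm (x i) \<le> B" using x by (auto simp: bounded_iff)
  define M where "M = (\<Sum>i<n. \<bar>a i\<bar> * B)"
  define g where "g A = norm (\<Sum>i<n. a i *\<^sub>R x (sorted_list_of_set A ! i))" for A
  have gM: "g A \<le> M" for A
    unfolding g_def M_def by (rule sum_norm_le) (auto intro!: mult_left_mono B)
  \<comment> \<open>An n-set is coloured by the integer part of \<open>g A / \<epsilon>\<close>:
    equal colours mean values within \<epsilon>, and the bound \<open>M\<close> leaves finitely many
    colours.\<close>
  define f where "f A = nat \<lfloor>g A / \<epsilon>\<rfloor>" for A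
  have "f A < Suc (nat \<lfloor>M / \<epsilon>\<rfloor>)" for A
  proof -
    have "g A / \<epsilon> \<le> M / \<epsilon>" using gM \<epsilon> by (simp add: divide_right_mono)
    then show ?thesis unfolding f_def less_Suc_eq_le by (intro nat_mono floor_mono)
  qed
  then obtain Y t where Y: "infinite Y" "\<And>A. A \<subseteq> Y \<Longrightarrow> finite A \<Longrightarrow> card A = n \<Longrightarrow> f A = t"
    using Ramsey[of "UNIV :: nat set" n f "Suc (nat \<lfloor>M / \<epsilon>\<rfloor>)"] by auto
  define r where "r = enumerate Y"
  have r: "strict_mono r" unfolding r_def by (rule strict_mono_enumerate[OF Y(1)])
  have key: "\<exists>A. f A = t \<and> g A = norm (\<Sum>i<n. a i *\<^sub>R x (r (\<kappa> i)))" if \<kappa>: "strict_mono \<kappa>" for \<kappa> :: "nat \<Rightarrow> nat"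
  proof (intro exI conjI)
    \<comment> \<open>The list is increasing without repetitions, so sorting its underlying set
      returns it and \<open>g\<close> evaluates to the intended norm.\<close>
    let ?l = "map (\<lambda>i. r (\<kappa> i)) [0..<n]"
    have sm: "strict_mono (\<lambda>i. r (\<kappa> i))" using r \<kappa> by (auto simp: strict_mono_def)
    have inj: "inj_on (\<lambda>i. r (\<kappa> i)) S" for S using strict_mono_imp_inj_on[OF sm] inj_on_subset by blast
    have "r i \<in> Y" for i unfolding r_def by (rule enumerate_in_set[OF Y(1)])
    then show "f (set ?l) = t" by (intro Y(2)) (auto simp: card_image[OF inj])
    have "sorted ?l" using sm by (auto simp: sorted_iff_nth_mono strict_mono_less_eq[OF sm])
    moreover have "distinct ?l" by (simp add: distinct_map inj)
    ultimately have "sorted_list_of_set (set ?l) = ?l" by (rule sorted_list_of_set.idem_if_sorted_distinct)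
    then show "g (set ?l) = norm (\<Sum>i<n. a i *\<^sub>R x (r (\<kappa> i)))" unfolding g_def by simp
  qed
  have close: "\<bar>g A - g A'\<bar> \<le> \<epsilon>" if ff: "f A = t" "f A' = t" for A A'
  proof -
    have "0 \<le> g A / \<epsilon>" "0 \<le> g A' / \<epsilon>" using \<epsilon> by (auto simp: g_def)
    then have "0 \<le> \<lfloor>g A / \<epsilon>\<rfloor>" "0 \<le> \<lfloor>g A' / \<epsilon>\<rfloor>" by simp_all
    moreover have "nat \<lfloor>g A / \<epsilon>\<rfloor> = nat \<lfloor>g A' / \<epsilon>\<rfloor>" using ff by (simp add: f_def)
    ultimately have "\<lfloor>g A / \<epsilon>\<rfloor> = \<lfloor>g A' / \<epsilon>\<rfloor>" by linarith
    then have "\<bar>g A / \<epsilon> - g A' / \<epsilon>\<bar> \<le> 1" by linarith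
    then have "\<bar>(g A - g A') / \<epsilon>\<bar> \<le> 1" by (simp add: diff_divide_distrib)
    then show ?thesis using \<epsilon> by (simp add: abs_divide)
  qed
  show ?thesis
  proof (intro exI[of _ r] conjI r allI impI)
    fix \<kappa> \<kappa>' :: "nat \<Rightarrow> nat" assume "strict_mono \<kappa>" "strict_mono \<kappa>'"
    then obtain A A' where "f A = t" "g A = norm (\<Sum>i<n. a i *\<^sub>R x (r (\<kappa> i)))"
      "f A' = t" "g A' = norm (\<Sum>i<n. a i *\<^sub>R x (r (\<kappa>' i)))" using key by blast
    then show "\<bar>norm (\<Sum>i<n. a i *\<^sub>R x (r (\<kappa> i))) - norm (\<Sum>i<n. a i *\<^sub>R x (r (\<kappa>' i)))\<bar> \<le> \<epsilon>"
      using close by metis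
  qed
qed

lemma Ramsey_norm_sum_finite:
  fixes x :: "nat \<Rightarrow> 'a::real_normed_vector" and G :: "(nat \<Rightarrow> real) set" and n :: nat
  assumes x: "bounded (range x)" and \<epsilon>: "\<epsilon> > 0" and "finite G"
  shows "\<exists>r :: nat \<Rightarrow> nat. strict_mono r \<and> (\<forall>a\<in>G. \<forall>\<kappa> \<kappa>'. strict_mono \<kappa> \<longrightarrow> strict_mono \<kappa>' \<longrightarrow>
     \<bar>norm (\<Sum>i<n. a i *\<^sub>R x (r (\<kappa> i))) - norm (\<Sum>i<n. a i *\<^sub>R x (r (\<kappa>' i)))\<bar> \<le> \<epsilon>)"
  using \<open>finite G\<close>
proof (induction G)
  case empty
  show ?case by (intro exI[of _ "\<lambda>i. i"]) (simp add: strict_mono_def)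
next
  case (insert b G)
  then obtain r :: "nat \<Rightarrow> nat" where r: "strict_mono r" "\<And>a \<kappa> \<kappa>'. a \<in> G \<Longrightarrow> strict_mono \<kappa> \<Longrightarrow> strict_mono \<kappa>' \<Longrightarrow>
     \<bar>norm (\<Sum>i<n. a i *\<^sub>R x (r (\<kappa> i))) - norm (\<Sum>i<n. a i *\<^sub>R x (r (\<kappa>' i)))\<bar> \<le> \<epsilon>"
    by blast
  have "bounded (range (\<lambda>i. x (r i)))" by (rule bounded_subset[OF x]) auto
  from Ramsey_norm_sum[OF this \<epsilon>, where n = n and a = b] obtain r' :: "nat \<Rightarrow> nat" where r': "strict_mono r'"
    "\<And>\<kappa> \<kappa>'. strict_mono \<kappa> \<Longrightarrow> strict_mono \<kappa>' \<Longrightarrow>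
     \<bar>norm (\<Sum>i<n. b i *\<^sub>R x (r (r' (\<kappa> i)))) - norm (\<Sum>i<n. b i *\<^sub>R x (r (r' (\<kappa>' i))))\<bar> \<le> \<epsilon>"
    by blast
  show ?case
  proof (intro exI[of _ "\<lambda>i. r (r' i)"] conjI ballI allI impI)
    show "strict_mono (\<lambda>i. r (r' i))" using r(1) r'(1) by (simp add: strict_mono_def)
    fix a and \<kappa> \<kappa>' :: "nat \<Rightarrow> nat"
    assume "a \<in> insert b G" and \<kappa>: "strict_mono \<kappa>" "strict_mono \<kappa>'"
    then consider "a = b" | "a \<in> G" by blast
    then show "\<bar>norm (\<Sum>i<n. a i *\<^sub>R x (r (r' (\<kappa> i)))) - norm (\<Sum>i<n. a i *\<^sub>R x (r (r' (\<kappa>' i))))\<bar> \<le> \<epsilon>"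
    proof cases
      case 1
      then show ?thesis using r'(2)[OF \<kappa>] by simp
    next
      case 2
      have "strict_mono (\<lambda>i. r' (\<kappa> i))" "strict_mono (\<lambda>i. r' (\<kappa>' i))"
        using r'(1) \<kappa> by (simp_all add: strict_mono_def)
      from r(2)[OF 2 this] show ?thesis .
    qed
  qed
qed

lemma Ramsey_norm_sum_uniform:
  fixes x :: "nat \<Rightarrow> 'a::real_normed_vector" and n :: nat
  assumes x: "bounded (range x)" and \<epsilon>: "\<epsilon> > 0"
  shows "\<exists>r :: nat \<Rightarrow> nat. strict_mono r \<and> (\<forall>a \<kappa> \<kappa>'. (\<forall>i<n. \<bar>a i\<bar> \<le> 1) \<longrightarrow> strict_mono \<kappa> \<longrightarrow> strict_mono \<kappa>' \<longrightarrow>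
     \<bar>norm (\<Sum>i<n. a i *\<^sub>R x (r (\<kappa> i))) - norm (\<Sum>i<n. a i *\<^sub>R x (r (\<kappa>' i)))\<bar> \<le> \<epsilon>)"
proof -
  obtain B where B: "\<And>i. norm (x i) \<le> B" using x by (auto simp: bounded_iff)
  obtain m :: nat where m: "m > 0" "3 * n * B / \<epsilon> < m"
    using reals_Archimedean2[of "max 1 (3 * n * B / \<epsilon>)"] by (metis max_less_iff_conj of_nat_0_less_iff order_less_trans zero_less_one)
  \<comment> \<open>\<open>G\<close> is a grid of mesh \<open>1 / m\<close> containing
    approximations to all coefficient vectors in the cube. Replacing coefficients by grid values
    changes the norm by at most \<open>n * B / m\<close>, a third of \<epsilon>; the grid estimate
    uses the remaining third. Values at indices from n on do not enter the sums.\<close>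
  define G where "G = (\<lambda>(k :: nat \<Rightarrow> int) i. k i / m) ` ({..<n} \<rightarrow>\<^sub>E {- int m..int m})"
  have "finite G" unfolding G_def by (intro finite_imageI finite_PiE) auto
  have "\<epsilon> / 3 > 0" using \<epsilon> by simp
  from Ramsey_norm_sum_finite[OF x this \<open>finite G\<close>, of n] obtain r :: "nat \<Rightarrow> nat" where r: "strict_mono r"
    "\<And>a \<kappa> \<kappa>'. a \<in> G \<Longrightarrow> strict_mono \<kappa> \<Longrightarrow> strict_mono \<kappa>' \<Longrightarrow>
     \<bar>norm (\<Sum>i<n. a i *\<^sub>R x (r (\<kappa> i))) - norm (\<Sum>i<n. a i *\<^sub>R x (r (\<kappa>' i)))\<bar> \<le> \<epsilon> / 3"
    by blast
  show ?thesis
  proof (intro exI[of _ r] conjI r allI impI)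
    fix a :: "nat \<Rightarrow> real" and \<kappa> \<kappa>' :: "nat \<Rightarrow> nat"
    assume a: "\<forall>i<n. \<bar>a i\<bar> \<le> 1" and \<kappa>: "strict_mono \<kappa>" "strict_mono \<kappa>'"
    define k where "k = restrict (\<lambda>i. \<lfloor>a i * m\<rfloor>) {..<n}"
    define b where "b i = k i / m" for i
    have "\<bar>a i * m\<bar> \<le> m" if "i < n" for i
      using a that m(1) by (simp add: abs_mult mult_left_le_one_le)
    then have "- int m \<le> \<lfloor>a i * m\<rfloor> \<and> \<lfloor>a i * m\<rfloor> \<le> int m" if "i < n" for i
      using that by (fastforce simp: abs_le_iff le_floor_iff floor_le_iff)
    then have "k \<in> {..<n} \<rightarrow>\<^sub>E {- int m..int m}" by (auto simp: k_def)
    then have bG: "b \<in> G" unfolding G_def b_def by blast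
    have ab: "\<bar>a i - b i\<bar> \<le> 1 / m" if "i < n" for i
    proof -
      have "\<bar>a i * m - k i\<bar> \<le> 1" using that by (simp add: k_def) linarith
      then have "\<bar>(a i * m - k i) / m\<bar> \<le> 1 / m" using m(1) by (simp add: abs_divide divide_right_mono)
      then show ?thesis using m(1) by (simp add: b_def diff_divide_distrib)
    qed
    have near: "\<bar>norm (\<Sum>i<n. a i *\<^sub>R x (r (\<kappa> i))) - norm (\<Sum>i<n. b i *\<^sub>R x (r (\<kappa> i)))\<bar> \<le> \<epsilon> / 3" for \<kappa>
    proof -
      have "\<bar>norm (\<Sum>i<n. a i *\<^sub>R x (r (\<kappa> i))) - norm (\<Sum>i<n. b i *\<^sub>R x (r (\<kappa> i)))\<bar>
          \<le> norm ((\<Sum>i<n. a i *\<^sub>R x (r (\<kappa> i))) - (\<Sum>i<n. b i *\<^sub>R x (r (\<kappa> i))))"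
        by (rule norm_triangle_ineq3)
      also have "\<dots> = norm (\<Sum>i<n. (a i - b i) *\<^sub>R x (r (\<kappa> i)))"
        by (simp add: sum_subtractf scaleR_diff_left)
      also have "\<dots> \<le> (\<Sum>i<n. 1 / m * B)"
      proof (rule sum_norm_le)
        fix i assume "i \<in> {..<n}"
        then have "\<bar>a i - b i\<bar> * norm (x (r (\<kappa> i))) \<le> 1 / m * B"
          by (intro mult_mono ab B) auto
        then show "norm ((a i - b i) *\<^sub>R x (r (\<kappa> i))) \<le> 1 / m * B" by simp
      qed
      also have "\<dots> = n * B / m" by simp
      also have "\<dots> \<le> \<epsilon> / 3" using m \<epsilon> by (simp add: field_simps)
      finally show ?thesis .
    qed
    show "\<bar>norm (\<Sum>i<n. a i *\<^sub>R x (r (\<kappa> i))) - norm (\<Sum>i<n. a i *\<^sub>R x (r (\<kappa>' i)))\<bar> \<le> \<epsilon>"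
      using near[of \<kappa>] near[of \<kappa>'] r(2)[OF bG \<kappa>] by linarith
  qed
qed

text \<open>This is the Cauchy form of the spreading model condition: sums over different late index
  sequences are compared with one another, so no limit seminorm has to be known yet.\<close>

definition asymptotically_spreading :: "(nat \<Rightarrow> 'a::real_normed_vector) \<Rightarrow> bool" where
  "asymptotically_spreading y \<longleftrightarrow> (\<forall>n::nat. \<forall>\<epsilon>>0. \<exists>n0. \<forall>a \<kappa> \<kappa>'. (\<forall>i<n. \<bar>a i\<bar> \<le> 1) \<longrightarrow>
     strict_mono \<kappa> \<longrightarrow> strict_mono \<kappa>' \<longrightarrow> n0 \<le> \<kappa> 0 \<longrightarrow> n0 \<le> \<kappa>' 0 \<longrightarrow>
     \<bar>norm (\<Sum>i<n. a i *\<^sub>R y (\<kappa> i)) - norm (\<Sum>i<n. a i *\<^sub>R y (\<kappa>' i))\<bar> \<le> \<epsilon>)"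

lemma Brunel_Sucheston:
  fixes x :: "nat \<Rightarrow> 'a::real_normed_vector"
  assumes x: "bounded (range x)"
  obtains r where "strict_mono r" "asymptotically_spreading (\<lambda>i. x (r i))"
proof -
  \<comment> \<open>A single parameter governs both the number of coefficients and the tolerance, so
    that one countable diagonal argument handles all pairs of a length and an \<epsilon>.\<close>
  define Q where "Q n s \<longleftrightarrow> (\<forall>a \<kappa> \<kappa>'. (\<forall>i<n. \<bar>a i\<bar> \<le> 1) \<longrightarrow> strict_mono \<kappa> \<longrightarrow> strict_mono \<kappa>' \<longrightarrow>
     \<bar>norm (\<Sum>i<n. a i *\<^sub>R x (s (\<kappa> i))) - norm (\<Sum>i<n. a i *\<^sub>R x (s (\<kappa>' i)))\<bar> \<le> inverse (real (Suc n)))"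
    for n :: nat and s :: "nat \<Rightarrow> nat"
  interpret subseqs Q
  proof
    fix n and s :: "nat \<Rightarrow> nat"
    have "bounded (range (\<lambda>i. x (s i)))" by (rule bounded_subset[OF x]) auto
    from Ramsey_norm_sum_uniform[OF this, of "inverse (real (Suc n))" n]
    show "\<exists>r. strict_mono r \<and> Q n (s \<circ> r)" by (simp add: Q_def)
  qed
  have Q: "Q k (diagseq \<circ> (+) (Suc k))" for k
  proof (rule diagseq_holds)
    fix r s :: "nat \<Rightarrow> nat" and n assume r: "strict_mono r" and s: "Q n s"
    show "Q n (s \<circ> r)" unfolding Q_def
    proof (intro allI impI)
      fix a :: "nat \<Rightarrow> real" and \<kappa> \<kappa>' :: "nat \<Rightarrow> nat"
      assume a: "\<forall>i<n. \<bar>a i\<bar> \<le> 1" and \<kappa>: "strict_mono \<kappa>" "strict_mono \<kappa>'"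
      have "strict_mono (\<lambda>i. r (\<kappa> i))" "strict_mono (\<lambda>i. r (\<kappa>' i))"
        using r \<kappa> by (simp_all add: strict_mono_def)
      with s a show "\<bar>norm (\<Sum>i<n. a i *\<^sub>R x ((s \<circ> r) (\<kappa> i))) - norm (\<Sum>i<n. a i *\<^sub>R x ((s \<circ> r) (\<kappa>' i)))\<bar>
          \<le> inverse (real (Suc n))" unfolding Q_def o_def by blast
    qed
  qed
  have "asymptotically_spreading (\<lambda>i. x (diagseq i))" unfolding asymptotically_spreading_def
  proof (intro allI impI)
    fix n :: nat and \<epsilon> :: real assume "\<epsilon> > 0"
    then obtain k0 where "inverse (real (Suc k0)) < \<epsilon>" using reals_Archimedean by blast
    moreover define k where "k = max n k0"
    have "inverse (real (Suc k)) \<le> inverse (real (Suc k0))" by (simp add: k_def)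
    ultimately have k: "n \<le> k" "inverse (real (Suc k)) \<le> \<epsilon>" unfolding k_def by linarith+
    show "\<exists>n0. \<forall>a \<kappa> \<kappa>'. (\<forall>i<n. \<bar>a i\<bar> \<le> 1) \<longrightarrow>
     strict_mono \<kappa> \<longrightarrow> strict_mono \<kappa>' \<longrightarrow> n0 \<le> \<kappa> 0 \<longrightarrow> n0 \<le> \<kappa>' 0 \<longrightarrow>
     \<bar>norm (\<Sum>i<n. a i *\<^sub>R x (diagseq (\<kappa> i))) - norm (\<Sum>i<n. a i *\<^sub>R x (diagseq (\<kappa>' i)))\<bar> \<le> \<epsilon>"
    proof (intro exI[of _ "Suc k"] allI impI)
      fix a :: "nat \<Rightarrow> real" and \<kappa> \<kappa>' :: "nat \<Rightarrow> nat"
      assume a: "\<forall>i<n. \<bar>a i\<bar> \<le> 1" and \<kappa>: "strict_mono \<kappa>" "strict_mono \<kappa>'" "Suc k \<le> \<kappa> 0" "Suc k \<le> \<kappa>' 0"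
      \<comment> \<open>Padding with zeros turns a sum of length n into one of length
        \<open>k\<close>, to which property \<open>Q k\<close> applies. Indices from
        \<open>Suc k\<close> on lie in the part of the diagonal that refines level
        \<open>k\<close>.\<close>
      define b where "b i = (if i < n then a i else 0)" for i
      have b: "\<forall>i<k. \<bar>b i\<bar> \<le> 1" using a by (simp add: b_def)
      have eq: "(\<Sum>i<k. b i *\<^sub>R x ((diagseq \<circ> (+) (Suc k)) (\<kappa> i - Suc k))) = (\<Sum>i<n. a i *\<^sub>R x (diagseq (\<kappa> i)))"
        and sm: "strict_mono (\<lambda>i. \<kappa> i - Suc k)"
        if "strict_mono \<kappa>" "Suc k \<le> \<kappa> 0" for \<kappa> :: "nat \<Rightarrow> nat"
      proof -
        have ge: "Suc k \<le> \<kappa> i" for i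
          using that strict_mono_less_eq[OF that(1), of 0 i] by simp
        then have "Suc k + (\<kappa> i - Suc k) = \<kappa> i" for i by (rule le_add_diff_inverse)
        then have "(\<Sum>i<k. b i *\<^sub>R x ((diagseq \<circ> (+) (Suc k)) (\<kappa> i - Suc k))) = (\<Sum>i<k. b i *\<^sub>R x (diagseq (\<kappa> i)))"
          by (simp only: o_def)
        also have "\<dots> = (\<Sum>i<n. a i *\<^sub>R x (diagseq (\<kappa> i)))"
          using k(1) by (intro sum.mono_neutral_cong_right) (auto simp: b_def)
        finally show "(\<Sum>i<k. b i *\<^sub>R x ((diagseq \<circ> (+) (Suc k)) (\<kappa> i - Suc k))) = (\<Sum>i<n. a i *\<^sub>R x (diagseq (\<kappa> i)))" .
        show "strict_mono (\<lambda>i. \<kappa> i - Suc k)"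
          using that(1) ge by (auto simp: strict_mono_def intro!: diff_less_mono)
      qed
      have "\<bar>norm (\<Sum>i<k. b i *\<^sub>R x ((diagseq \<circ> (+) (Suc k)) (\<kappa> i - Suc k))) -
          norm (\<Sum>i<k. b i *\<^sub>R x ((diagseq \<circ> (+) (Suc k)) (\<kappa>' i - Suc k)))\<bar> \<le> inverse (real (Suc k))"
        using iffD1[OF Q_def Q[of k], rule_format, of b "\<lambda>i. \<kappa> i - Suc k" "\<lambda>i. \<kappa>' i - Suc k"]
          b sm[OF \<kappa>(1,3)] sm[OF \<kappa>(2,4)] by blast
      then show "\<bar>norm (\<Sum>i<n. a i *\<^sub>R x (diagseq (\<kappa> i))) - norm (\<Sum>i<n. a i *\<^sub>R x (diagseq (\<kappa>' i)))\<bar> \<le> \<epsilon>"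
        unfolding eq[OF \<kappa>(1,3)] eq[OF \<kappa>(2,4)] using k(2) by linarith
    qed
  qed
  with subseq_diagseq show thesis by (rule that)
qed

section \<open>The norm of a spreading model\<close>

text \<open>The limit is taken along blocks of consecutive indices, which suffices because spreading
  sequences give asymptotically the same value on all increasing index choices. Summing over the
  support avoids a choice of length.\<close>

definition spreading_norm :: "(nat \<Rightarrow> 'a::real_normed_vector) \<Rightarrow> (nat \<Rightarrow> real) \<Rightarrow> real" where
  "spreading_norm y a = lim (\<lambda>j. norm (\<Sum>i | a i \<noteq> 0. a i *\<^sub>R y (j + i)))"

lemma fin_supp_iff: "fin_supp a \<longleftrightarrow> (\<exists>n. \<forall>i\<ge>n. a i = 0)"
proof
  assume "fin_supp a"
  then obtain n where "\<forall>i\<in>{i. a i \<noteq> 0}. i < n"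
    unfolding fin_supp_def using finite_nat_set_iff_bounded by blast
  then show "\<exists>n. \<forall>i\<ge>n. a i = 0" by (intro exI[of _ n]) (auto simp: leD)
next
  assume "\<exists>n. \<forall>i\<ge>n. a i = 0"
  then obtain n where "\<forall>i\<ge>n. a i = 0" by blast
  then have "{i. a i \<noteq> 0} \<subseteq> {..<n}" using not_le by auto
  then show "fin_supp a" unfolding fin_supp_def using finite_subset by blast
qed

lemma tendsto_spreading_norm:
  assumes y: "asymptotically_spreading y" and a: "\<forall>i\<ge>n. a i = 0"
  shows "(\<lambda>j. norm (\<Sum>i<n. a i *\<^sub>R y (j + i))) \<longlonglongrightarrow> spreading_norm y a"
proof -
  \<comment> \<open>Division by \<open>M\<close> brings the coefficients into [-1, 1], where the
    spreading condition is available; the summand 1 keeps \<open>M\<close> positive for the zero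
    sequence.\<close>
  define M where "M = 1 + (\<Sum>i<n. \<bar>a i\<bar>)"
  have M: "M > 0" by (simp add: M_def add_pos_nonneg sum_nonneg)
  define b where "b i = a i / M" for i
  have b1: "\<forall>i<n. \<bar>b i\<bar> \<le> 1"
  proof (intro allI impI)
    fix i assume "i < n"
    then have "\<bar>a i\<bar> \<le> (\<Sum>i<n. \<bar>a i\<bar>)" by (intro member_le_sum) auto
    then have "\<bar>a i\<bar> \<le> M" by (simp add: M_def)
    then show "\<bar>b i\<bar> \<le> 1" using M by (simp add: b_def abs_divide)
  qed
  define f where "f j = norm (\<Sum>i<n. b i *\<^sub>R y (j + i))" for j
  have "Cauchy f"
  proof (rule metric_CauchyI)
    fix e :: real assume e: "e > 0"
    then obtain n0 where n0: "\<And>a \<kappa> \<kappa>'. (\<forall>i<n. \<bar>a i\<bar> \<le> 1) \<Longrightarrow> strict_mono \<kappa> \<Longrightarrow> strict_mono \<kappa>' \<Longrightarrow>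
        n0 \<le> \<kappa> 0 \<Longrightarrow> n0 \<le> \<kappa>' 0 \<Longrightarrow>
        \<bar>norm (\<Sum>i<n. a i *\<^sub>R y (\<kappa> i)) - norm (\<Sum>i<n. a i *\<^sub>R y (\<kappa>' i))\<bar> \<le> e / 2"
      using y[unfolded asymptotically_spreading_def, rule_format, of "e / 2" n] by fastforce
    have "dist (f p) (f q) < e" if "n0 \<le> p" "n0 \<le> q" for p q
      using n0[OF b1, of "\<lambda>i. p + i" "\<lambda>i. q + i"] that e
      by (simp add: f_def dist_real_def strict_mono_def)
    then show "\<exists>m0. \<forall>p\<ge>m0. \<forall>q\<ge>m0. dist (f p) (f q) < e" by blast
  qed
  then have "convergent f" by (simp add: Cauchy_convergent)
  then have "convergent (\<lambda>j. M * f j)" by (intro convergent_mult convergent_const)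
  moreover have eq: "M * f j = norm (\<Sum>i<n. a i *\<^sub>R y (j + i))" for j
  proof -
    have "M * f j = norm (M *\<^sub>R (\<Sum>i<n. b i *\<^sub>R y (j + i)))" using M by (simp add: f_def)
    also have "M *\<^sub>R (\<Sum>i<n. b i *\<^sub>R y (j + i)) = (\<Sum>i<n. a i *\<^sub>R y (j + i))"
      using M by (simp add: scaleR_sum_right b_def)
    finally show ?thesis .
  qed
  moreover have "(\<Sum>i | a i \<noteq> 0. a i *\<^sub>R y (j + i)) = (\<Sum>i<n. a i *\<^sub>R y (j + i))" for j
    using a by (intro sum.mono_neutral_left) (auto simp: not_le[symmetric])
  ultimately show ?thesis unfolding spreading_norm_def by (simp add: convergent_LIMSEQ_iff)
qed

text \<open>An arbitrary late \<open>\<kappa>\<close> is compared with the block of consecutive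
  indices starting at j, and j tends to infinity in that comparison.\<close>

lemma spreading_norm_uniform:
  assumes y: "asymptotically_spreading y" and \<epsilon>: "\<epsilon> > 0"
  shows "\<exists>n0. \<forall>a \<kappa>. (\<forall>i<n. \<bar>a i\<bar> \<le> 1) \<longrightarrow> strict_mono \<kappa> \<longrightarrow> n0 \<le> \<kappa> 0 \<longrightarrow>
     \<bar>norm (\<Sum>i<n. a i *\<^sub>R y (\<kappa> i)) - spreading_norm y (\<lambda>i. if i < n then a i else 0)\<bar> \<le> \<epsilon>"
proof -
  obtain n0 where n0: "\<And>a \<kappa> \<kappa>'. (\<forall>i<n. \<bar>a i\<bar> \<le> 1) \<Longrightarrow> strict_mono \<kappa> \<Longrightarrow> strict_mono \<kappa>' \<Longrightarrow>
        n0 \<le> \<kappa> 0 \<Longrightarrow> n0 \<le> \<kappa>' 0 \<Longrightarrow>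
        \<bar>norm (\<Sum>i<n. a i *\<^sub>R y (\<kappa> i)) - norm (\<Sum>i<n. a i *\<^sub>R y (\<kappa>' i))\<bar> \<le> \<epsilon>"
    using y[unfolded asymptotically_spreading_def, rule_format, of \<epsilon> n] \<epsilon> by blast
  show ?thesis
  proof (intro exI[of _ n0] allI impI)
    fix a :: "nat \<Rightarrow> real" and \<kappa> :: "nat \<Rightarrow> nat"
    assume a: "\<forall>i<n. \<bar>a i\<bar> \<le> 1" and \<kappa>: "strict_mono \<kappa>" "n0 \<le> \<kappa> 0"
    have "(\<lambda>j. norm (\<Sum>i<n. (if i < n then a i else 0) *\<^sub>R y (j + i))) \<longlonglongrightarrow>
        spreading_norm y (\<lambda>i. if i < n then a i else 0)"
      by (rule tendsto_spreading_norm[OF y]) simp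
    moreover have "(\<Sum>i<n. (if i < n then a i else 0) *\<^sub>R y (j + i)) = (\<Sum>i<n. a i *\<^sub>R y (j + i))" for j
      by (intro sum.cong) auto
    ultimately have lim: "(\<lambda>j. norm (\<Sum>i<n. a i *\<^sub>R y (j + i))) \<longlonglongrightarrow>
        spreading_norm y (\<lambda>i. if i < n then a i else 0)" by simp
    show "\<bar>norm (\<Sum>i<n. a i *\<^sub>R y (\<kappa> i)) - spreading_norm y (\<lambda>i. if i < n then a i else 0)\<bar> \<le> \<epsilon>"
    proof (rule LIMSEQ_le_const2)
      show "(\<lambda>j. \<bar>norm (\<Sum>i<n. a i *\<^sub>R y (\<kappa> i)) - norm (\<Sum>i<n. a i *\<^sub>R y (j + i))\<bar>) \<longlonglongrightarrow>
          \<bar>norm (\<Sum>i<n. a i *\<^sub>R y (\<kappa> i)) - spreading_norm y (\<lambda>i. if i < n then a i else 0)\<bar>"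
        by (intro tendsto_rabs tendsto_diff tendsto_const lim)
      have "\<bar>norm (\<Sum>i<n. a i *\<^sub>R y (\<kappa> i)) - norm (\<Sum>i<n. a i *\<^sub>R y (j + i))\<bar> \<le> \<epsilon>" if "j \<ge> n0" for j
        using n0[OF a \<kappa>(1), of "\<lambda>i. j + i"] \<kappa>(2) that by (simp add: strict_mono_def)
      then show "\<exists>N. \<forall>j\<ge>N. \<bar>norm (\<Sum>i<n. a i *\<^sub>R y (\<kappa> i)) - norm (\<Sum>i<n. a i *\<^sub>R y (j + i))\<bar> \<le> \<epsilon>"
        by blast
    qed
  qed
qed

lemma spreading_norm_nonneg:
  assumes "asymptotically_spreading y" "fin_supp a"
  shows "0 \<le> spreading_norm y a"
proof -
  obtain n where "\<forall>i\<ge>n. a i = 0" using assms(2) by (auto simp: fin_supp_iff)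
  from tendsto_spreading_norm[OF assms(1) this] show ?thesis by (rule LIMSEQ_le_const) simp
qed

lemma spreading_norm_scale:
  assumes y: "asymptotically_spreading y" and "fin_supp a"
  shows "spreading_norm y (\<lambda>i. c * a i) = \<bar>c\<bar> * spreading_norm y a"
proof -
  obtain n where n: "\<forall>i\<ge>n. a i = 0" using assms(2) by (auto simp: fin_supp_iff)
  then have n': "\<forall>i\<ge>n. c * a i = 0" by simp
  have eq: "norm (\<Sum>i<n. (c * a i) *\<^sub>R y (j + i)) = \<bar>c\<bar> * norm (\<Sum>i<n. a i *\<^sub>R y (j + i))" for j
  proof -
    have "(\<Sum>i<n. (c * a i) *\<^sub>R y (j + i)) = c *\<^sub>R (\<Sum>i<n. a i *\<^sub>R y (j + i))"
      by (simp add: scaleR_sum_right)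
    then show ?thesis by simp
  qed
  have "(\<lambda>j. \<bar>c\<bar> * norm (\<Sum>i<n. a i *\<^sub>R y (j + i))) \<longlonglongrightarrow> \<bar>c\<bar> * spreading_norm y a"
    by (intro tendsto_mult tendsto_const tendsto_spreading_norm[OF y n])
  with tendsto_spreading_norm[OF y n'] show ?thesis unfolding eq by (rule LIMSEQ_unique)
qed

lemma spreading_norm_triangle:
  assumes y: "asymptotically_spreading y" and "fin_supp a" "fin_supp b"
  shows "spreading_norm y (\<lambda>i. a i + b i) \<le> spreading_norm y a + spreading_norm y b"
proof -
  obtain m where m: "\<forall>i\<ge>m. a i = 0" using assms(2) by (auto simp: fin_supp_iff)
  obtain k where k: "\<forall>i\<ge>k. b i = 0" using assms(3) by (auto simp: fin_supp_iff)
  define n where "n = max m k"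
  have a: "\<forall>i\<ge>n. a i = 0" and b: "\<forall>i\<ge>n. b i = 0" and ab: "\<forall>i\<ge>n. a i + b i = 0"
    using m k by (auto simp: n_def)
  show ?thesis
  proof (rule LIMSEQ_le[OF tendsto_spreading_norm[OF y ab]
        tendsto_add[OF tendsto_spreading_norm[OF y a] tendsto_spreading_norm[OF y b]]])
    show "\<exists>N. \<forall>j\<ge>N. norm (\<Sum>i<n. (a i + b i) *\<^sub>R y (j + i)) \<le>
        norm (\<Sum>i<n. a i *\<^sub>R y (j + i)) + norm (\<Sum>i<n. b i *\<^sub>R y (j + i))"
      by (simp add: scaleR_left_distrib sum.distrib norm_triangle_ineq)
  qed
qed

lemma seminorm_fs_spreading_norm: "asymptotically_spreading y \<Longrightarrow> seminorm_fs (spreading_norm y)"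
  by (simp add: seminorm_fs_def spreading_norm_nonneg spreading_norm_scale spreading_norm_triangle)

lemma generates_spreading_model_spreading_norm:
  assumes r: "strict_mono r" and y: "asymptotically_spreading (\<lambda>i. x (r i))"
  shows "generates_spreading_model x r (spreading_norm (\<lambda>i. x (r i)))"
  unfolding generates_spreading_model_def
proof (intro conjI r seminorm_fs_spreading_norm[OF y] allI impI)
  fix n :: nat and \<epsilon> :: real assume "\<epsilon> > 0"
  then obtain n0 where n0: "\<And>a \<kappa>. (\<forall>i<n. \<bar>a i\<bar> \<le> 1) \<Longrightarrow> strict_mono \<kappa> \<Longrightarrow> n0 \<le> \<kappa> 0 \<Longrightarrow>
     \<bar>norm (\<Sum>i<n. a i *\<^sub>R x (r (\<kappa> i))) - spreading_norm (\<lambda>i. x (r i)) (\<lambda>i. if i < n then a i else 0)\<bar> \<le> \<epsilon> / 2"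
    using spreading_norm_uniform[OF y, of "\<epsilon> / 2" n] by auto
  show "\<exists>n0. \<forall>\<kappa> a. strict_mono_on {..<n} \<kappa> \<and> (n > 0 \<longrightarrow> n0 \<le> \<kappa> 0) \<and> (\<forall>i<n. \<bar>a i\<bar> \<le> 1) \<longrightarrow>
        \<bar>norm (\<Sum>i<n. a i *\<^sub>R x (r (\<kappa> i))) - spreading_norm (\<lambda>i. x (r i)) (\<lambda>i. if i < n then a i else 0)\<bar> < \<epsilon>"
  proof (intro exI[of _ n0] allI impI, elim conjE)
    fix \<kappa> :: "nat \<Rightarrow> nat" and a :: "nat \<Rightarrow> real"
    assume \<kappa>: "strict_mono_on {..<n} \<kappa>" "n > 0 \<longrightarrow> n0 \<le> \<kappa> 0" and a: "\<forall>i<n. \<bar>a i\<bar> \<le> 1"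
    obtain \<kappa>' where \<kappa>': "strict_mono \<kappa>'" "\<And>i. i < n \<Longrightarrow> \<kappa>' i = \<kappa> i"
      using strict_mono_extension[OF \<kappa>(1)] by blast
    \<comment> \<open>For n = 0 nothing is known about \<open>\<kappa> 0\<close>, so the index
      sequence is then replaced by one starting at \<open>n0\<close>; the sum is empty
      anyway.\<close>
    have "strict_mono (\<lambda>i. if n > 0 then \<kappa>' i else n0 + i)" using \<kappa>'(1) by (simp add: strict_mono_def)
    moreover have "n0 \<le> (if n > 0 then \<kappa>' 0 else n0 + 0)" using \<kappa>(2) \<kappa>'(2)[of 0] by simp
    ultimately have "\<bar>norm (\<Sum>i<n. a i *\<^sub>R x (r (if n > 0 then \<kappa>' i else n0 + i))) -
        spreading_norm (\<lambda>i. x (r i)) (\<lambda>i. if i < n then a i else 0)\<bar> \<le> \<epsilon> / 2"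
      by (rule n0[OF a])
    moreover have "(\<Sum>i<n. a i *\<^sub>R x (r (if n > 0 then \<kappa>' i else n0 + i))) = (\<Sum>i<n. a i *\<^sub>R x (r (\<kappa> i)))"
      using \<kappa>'(2) by (intro sum.cong) auto
    ultimately show "\<bar>norm (\<Sum>i<n. a i *\<^sub>R x (r (\<kappa> i))) -
        spreading_norm (\<lambda>i. x (r i)) (\<lambda>i. if i < n then a i else 0)\<bar> < \<epsilon>"
      using \<open>\<epsilon> > 0\<close> by simp
  qed
qed

text \<open>For one fixed coefficient sequence the restriction to [-1, 1] is removed by
  homogeneity.\<close>

lemma spreading_norm_approx:
  assumes y: "asymptotically_spreading y" and a: "\<forall>i\<ge>n. a i = 0" and \<epsilon>: "\<epsilon> > 0"
  obtains n0 where "\<And>\<kappa>. strict_mono \<kappa> \<Longrightarrow> n0 \<le> \<kappa> 0 \<Longrightarrow>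
     \<bar>norm (\<Sum>i<n. a i *\<^sub>R y (\<kappa> i)) - spreading_norm y a\<bar> \<le> \<epsilon>"
proof -
  define M where "M = 1 + (\<Sum>i<n. \<bar>a i\<bar>)"
  have M: "M > 0" by (simp add: M_def add_pos_nonneg sum_nonneg)
  define b where "b i = a i / M" for i
  have b1: "\<forall>i<n. \<bar>b i\<bar> \<le> 1"
  proof (intro allI impI)
    fix i assume "i < n"
    then have "\<bar>a i\<bar> \<le> (\<Sum>i<n. \<bar>a i\<bar>)" by (intro member_le_sum) auto
    then have "\<bar>a i\<bar> \<le> M" by (simp add: M_def)
    then show "\<bar>b i\<bar> \<le> 1" using M by (simp add: b_def abs_divide)
  qed
  have "fin_supp b" using a by (auto simp: fin_supp_iff b_def)
  then have "spreading_norm y (\<lambda>i. M * b i) = \<bar>M\<bar> * spreading_norm y b"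
    by (rule spreading_norm_scale[OF y])
  then have Na: "spreading_norm y a = M * spreading_norm y b" using M by (simp add: b_def)
  have cut: "(\<lambda>i. if i < n then b i else 0) = b" using a by (auto simp: b_def fun_eq_iff)
  have "\<epsilon> / M > 0" using \<epsilon> M by simp
  from spreading_norm_uniform[OF y this, of n] obtain n0
    where n0: "\<And>a \<kappa>. (\<forall>i<n. \<bar>a i\<bar> \<le> 1) \<Longrightarrow> strict_mono \<kappa> \<Longrightarrow> n0 \<le> \<kappa> 0 \<Longrightarrow>
     \<bar>norm (\<Sum>i<n. a i *\<^sub>R y (\<kappa> i)) - spreading_norm y (\<lambda>i. if i < n then a i else 0)\<bar> \<le> \<epsilon> / M"
    by blast
  show thesis
  proof (rule that[of n0])
    fix \<kappa> :: "nat \<Rightarrow> nat" assume "strict_mono \<kappa>" "n0 \<le> \<kappa> 0"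
    from n0[OF b1 this] have h: "\<bar>norm (\<Sum>i<n. b i *\<^sub>R y (\<kappa> i)) - spreading_norm y b\<bar> \<le> \<epsilon> / M"
      by (simp only: cut)
    have "(\<Sum>i<n. a i *\<^sub>R y (\<kappa> i)) = M *\<^sub>R (\<Sum>i<n. b i *\<^sub>R y (\<kappa> i))"
      using M by (simp add: scaleR_sum_right b_def)
    then have "norm (\<Sum>i<n. a i *\<^sub>R y (\<kappa> i)) = M * norm (\<Sum>i<n. b i *\<^sub>R y (\<kappa> i))" using M by simp
    then have "\<bar>norm (\<Sum>i<n. a i *\<^sub>R y (\<kappa> i)) - spreading_norm y a\<bar> =
        M * \<bar>norm (\<Sum>i<n. b i *\<^sub>R y (\<kappa> i)) - spreading_norm y b\<bar>"
      using M by (simp add: Na right_diff_distrib[symmetric] abs_mult)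
    also have "\<dots> \<le> M * (\<epsilon> / M)" using h M by (intro mult_left_mono) auto
    finally show "\<bar>norm (\<Sum>i<n. a i *\<^sub>R y (\<kappa> i)) - spreading_norm y a\<bar> \<le> \<epsilon>" using M by simp
  qed
qed

text \<open>Shifting the coefficients by \<open>p\<close> merely starts the blocks \<open>p\<close>
  places later, which the limit does not see. This invariance is what the averaging argument rests
  on.\<close>

lemma spreading_norm_shift:
  assumes y: "asymptotically_spreading y" and "fin_supp a"
  shows "spreading_norm y (\<lambda>i. if i < p then 0 else a (i - p)) = spreading_norm y a"
proof -
  obtain n where n: "\<forall>i\<ge>n. a i = 0" using assms(2) by (auto simp: fin_supp_iff)
  let ?b = "\<lambda>i. if i < p then 0 else a (i - p)"
  have eq: "(\<Sum>i<p + n. ?b i *\<^sub>R y (j + i)) = (\<Sum>i<n. a i *\<^sub>R y ((j + p) + i))" for j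
  proof -
    have "(\<Sum>i<p + n. ?b i *\<^sub>R y (j + i)) = (\<Sum>i\<in>{p..<p + n}. ?b i *\<^sub>R y (j + i))"
      by (intro sum.mono_neutral_right) auto
    also have "\<dots> = (\<Sum>i<n. a i *\<^sub>R y ((j + p) + i))"
      by (rule sum.reindex_bij_witness[of _ "\<lambda>i. i + p" "\<lambda>i. i - p"]) auto
    finally show ?thesis .
  qed
  have "(\<lambda>j. norm (\<Sum>i<n. a i *\<^sub>R y ((j + p) + i))) \<longlonglongrightarrow> spreading_norm y ?b"
    using tendsto_spreading_norm[OF y, of "p + n" ?b] n unfolding eq by simp
  moreover have "(\<lambda>j. norm (\<Sum>i<n. a i *\<^sub>R y ((j + p) + i))) \<longlonglongrightarrow> spreading_norm y a"
    using LIMSEQ_ignore_initial_segment[OF tendsto_spreading_norm[OF y n], of p] by simp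
  ultimately show ?thesis by (rule LIMSEQ_unique)
qed

lemma spreading_norm_sum:
  assumes y: "asymptotically_spreading y" and "finite I" and "\<And>p. p \<in> I \<Longrightarrow> fin_supp (g p)"
  shows "fin_supp (\<lambda>i. \<Sum>p\<in>I. g p i) \<and>
    spreading_norm y (\<lambda>i. \<Sum>p\<in>I. g p i) \<le> (\<Sum>p\<in>I. spreading_norm y (g p))"
  using assms(2,3)
proof (induction I)
  case empty
  have "fin_supp (\<lambda>_. 0)" by (simp add: fin_supp_def)
  then show ?case using spreading_norm_scale[OF y, of "\<lambda>_. 0" 0] by simp
next
  case (insert q I)
  have *: "fin_supp (\<lambda>i. a i + b i)" if "fin_supp a" "fin_supp b" for a b
    using that unfolding fin_supp_def by (rule finite_subset[rotated, OF finite_UnI]) auto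
  then show ?case using insert spreading_norm_triangle[OF y, of "g q" "\<lambda>i. \<Sum>p\<in>I. g p i"] by fastforce
qed

section \<open>Suppression unconditionality\<close>

lemma convex_hull_tail_finite:
  assumes "v \<in> convex hull (y ` {K::nat..})"
  obtains L where "K \<le> L" "v \<in> convex hull (y ` {K..L})"
proof -
  \<comment> \<open>An increasing union of convex sets is convex. The finite bound L leaves indices
    beyond the block for the later terms of a sum.\<close>
  let ?U = "{v. \<exists>L\<ge>K. v \<in> convex hull (y ` {K..L})}"
  have mono: "convex hull (y ` {K..L}) \<subseteq> convex hull (y ` {K..L'})" if "L \<le> L'" for L L'
    using that by (intro hull_mono) auto
  have "convex ?U"
  proof (rule convexI)
    fix v w and s t :: real assume "v \<in> ?U" "w \<in> ?U" and st: "0 \<le> s" "0 \<le> t" "s + t = 1"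
    then obtain L L' where L: "L \<ge> K" "v \<in> convex hull (y ` {K..L})" "w \<in> convex hull (y ` {K..L'})"
      by blast
    have "v \<in> convex hull (y ` {K..max L L'})" using L(2) mono[of L "max L L'"] by auto
    moreover have "w \<in> convex hull (y ` {K..max L L'})" using L(3) mono[of L' "max L L'"] by auto
    ultimately have "s *\<^sub>R v + t *\<^sub>R w \<in> convex hull (y ` {K..max L L'})"
      using st by (intro convexD[OF convex_convex_hull]) auto
    moreover have "K \<le> max L L'" using L(1) by simp
    ultimately show "s *\<^sub>R v + t *\<^sub>R w \<in> ?U" by blast
  qed
  moreover have "y ` {K..} \<subseteq> ?U"
  proof
    fix w assume "w \<in> y ` {K..}"
    then obtain m where m: "w = y m" "K \<le> m" by auto
    then have "w \<in> convex hull (y ` {K..m})" by (intro hull_inc) auto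
    then show "w \<in> ?U" using m(2) by blast
  qed
  ultimately have "convex hull (y ` {K..}) \<subseteq> ?U" by (intro hull_minimal)
  then show thesis using assms that by blast
qed

text \<open>Suppression unconditionality: in a sum approximating \<open>spreading_norm y a\<close> the vector
  in position \<open>k\<close> may be replaced by any vector of a block, hence by a convex combination
  of the block, which can be chosen of small norm.\<close>

lemma spreading_norm_suppress1:
  assumes y: "asymptotically_spreading y" and mazur: "\<And>K. 0 \<in> closure (convex hull (y ` {K::nat..}))"
    and "fin_supp a"
  shows "spreading_norm y (a(k := 0)) \<le> spreading_norm y a"
proof -
  obtain n where n: "\<forall>i\<ge>n. a i = 0" using assms(3) by (auto simp: fin_supp_iff)
  show ?thesis
  proof (cases "k < n")
    case False
    then have "a(k := 0) = a" using n by (auto simp: fun_eq_iff)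
    then show ?thesis by simp
  next
    case k: True
    show ?thesis
    proof (rule field_le_epsilon)
      fix e :: real assume "e > 0"
      define \<epsilon> where "\<epsilon> = e / 3"
      have \<epsilon>: "\<epsilon> > 0" using \<open>e > 0\<close> by (simp add: \<epsilon>_def)
      have n': "\<forall>i\<ge>n. (a(k := 0)) i = 0" using n by simp
      obtain n1 where n1: "\<And>\<kappa>. strict_mono \<kappa> \<Longrightarrow> n1 \<le> \<kappa> 0 \<Longrightarrow>
         \<bar>norm (\<Sum>i<n. a i *\<^sub>R y (\<kappa> i)) - spreading_norm y a\<bar> \<le> \<epsilon>"
        using spreading_norm_approx[OF y n \<epsilon>] by blast
      obtain n2 where n2: "\<And>\<kappa>. strict_mono \<kappa> \<Longrightarrow> n2 \<le> \<kappa> 0 \<Longrightarrow>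
         \<bar>norm (\<Sum>i<n. (a(k := 0)) i *\<^sub>R y (\<kappa> i)) - spreading_norm y (a(k := 0))\<bar> \<le> \<epsilon>"
        using spreading_norm_approx[OF y n' \<epsilon>] by blast
      define n0 where "n0 = max n1 n2"
      define K where "K = n0 + k"
      have "\<epsilon> / (\<bar>a k\<bar> + 1) > 0" using \<epsilon> by (simp add: add_nonneg_pos)
      then obtain v where v: "v \<in> convex hull (y ` {K..})" "dist v 0 < \<epsilon> / (\<bar>a k\<bar> + 1)"
        using mazur[of K] unfolding closure_approachable by blast
      have "\<bar>a k\<bar> * norm v \<le> (\<bar>a k\<bar> + 1) * norm v" by (simp add: mult_right_mono)
      also have "\<dots> \<le> \<epsilon>" using v(2) by (simp add: pos_less_divide_eq add_nonneg_pos mult.commute less_imp_le)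
      finally have v\<epsilon>: "norm (a k *\<^sub>R v) \<le> \<epsilon>" by simp
      obtain L where L: "K \<le> L" "v \<in> convex hull (y ` {K..L})"
        using convex_hull_tail_finite[OF v(1)] by blast
      \<comment> \<open>Only position k varies with m. Earlier indices stay below
        \<open>K = n0 + k\<close> and later ones exceed \<open>L\<close>, so each m from
        \<open>K\<close> to \<open>L\<close> gives an increasing sequence, and the sum
        \<open>w\<close> of the other terms is independent of m.\<close>
      define \<kappa> where "\<kappa> m i = (if i < k then n0 + i else if i = k then m else L + i)" for m i :: nat
      have \<kappa>: "strict_mono (\<kappa> m)" "n1 \<le> \<kappa> m 0" "n2 \<le> \<kappa> m 0" if "K \<le> m" "m \<le> L" for m
        using that by (auto simp: \<kappa>_def K_def n0_def strict_mono_Suc_iff)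
      define w where "w = (\<Sum>i\<in>{..<n} - {k}. a i *\<^sub>R y (\<kappa> K i))"
      have sum_a: "(\<Sum>i<n. a i *\<^sub>R y (\<kappa> m i)) = w + a k *\<^sub>R y m" for m
      proof -
        have "(\<Sum>i<n. a i *\<^sub>R y (\<kappa> m i)) = a k *\<^sub>R y (\<kappa> m k) + (\<Sum>i\<in>{..<n} - {k}. a i *\<^sub>R y (\<kappa> m i))"
          using k by (intro sum.remove) auto
        also have "(\<Sum>i\<in>{..<n} - {k}. a i *\<^sub>R y (\<kappa> m i)) = w"
          unfolding w_def by (intro sum.cong) (auto simp: \<kappa>_def)
        finally show ?thesis by (simp add: \<kappa>_def)
      qed
      have sum_b: "(\<Sum>i<n. (a(k := 0)) i *\<^sub>R y (\<kappa> K i)) = w"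
        unfolding w_def by (rule sum.mono_neutral_cong_right) auto
      \<comment> \<open>A sublevel set of a convex function of u: it contains every vector of the
        block, hence also the small convex combination v.\<close>
      let ?S = "{u. norm (w + a k *\<^sub>R u) \<le> spreading_norm y a + \<epsilon>}"
      have "convex ?S"
      proof (rule convexI)
        fix u u' and s t :: real assume u: "u \<in> ?S" "u' \<in> ?S" and st: "0 \<le> s" "0 \<le> t" "s + t = 1"
        have "w + a k *\<^sub>R (s *\<^sub>R u + t *\<^sub>R u') = (s + t) *\<^sub>R w + a k *\<^sub>R (s *\<^sub>R u + t *\<^sub>R u')"
          using st by simp
        also have "\<dots> = s *\<^sub>R (w + a k *\<^sub>R u) + t *\<^sub>R (w + a k *\<^sub>R u')"
          by (simp add: algebra_simps)
        finally have "norm (w + a k *\<^sub>R (s *\<^sub>R u + t *\<^sub>R u')) \<le> s * norm (w + a k *\<^sub>R u) + t * norm (w + a k *\<^sub>R u')"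
          using st norm_triangle_ineq[of "s *\<^sub>R (w + a k *\<^sub>R u)" "t *\<^sub>R (w + a k *\<^sub>R u')"] by simp
        also have "\<dots> \<le> s * (spreading_norm y a + \<epsilon>) + t * (spreading_norm y a + \<epsilon>)"
          using u st by (intro add_mono mult_left_mono) auto
        also have "\<dots> = spreading_norm y a + \<epsilon>" using st by (simp add: distrib_right[symmetric])
        finally show "s *\<^sub>R u + t *\<^sub>R u' \<in> ?S" by simp
      qed
      moreover have "y ` {K..L} \<subseteq> ?S"
      proof
        fix u assume "u \<in> y ` {K..L}"
        then obtain m where m: "u = y m" "K \<le> m" "m \<le> L" by auto
        show "u \<in> ?S" using n1[OF \<kappa>(1,2)[OF m(2,3)]] unfolding sum_a m(1) by simp
      qed
      ultimately have "convex hull (y ` {K..L}) \<subseteq> ?S" by (intro hull_minimal)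
      then have "norm (w + a k *\<^sub>R v) \<le> spreading_norm y a + \<epsilon>" using L(2) by auto
      moreover have "norm w \<le> norm (w + a k *\<^sub>R v) + norm (a k *\<^sub>R v)"
        using norm_triangle_ineq4[of "w + a k *\<^sub>R v" "a k *\<^sub>R v"] by simp
      moreover have "\<bar>norm w - spreading_norm y (a(k := 0))\<bar> \<le> \<epsilon>"
        using n2[OF \<kappa>(1,3)[OF order_refl L(1)]] unfolding sum_b .
      ultimately show "spreading_norm y (a(k := 0)) \<le> spreading_norm y a + e"
        using v\<epsilon> unfolding \<epsilon>_def by linarith
    qed
  qed
qed

lemma spreading_norm_suppress:
  assumes y: "asymptotically_spreading y" and mazur: "\<And>K. 0 \<in> closure (convex hull (y ` {K::nat..}))"
    and a: "fin_supp a"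
  shows "spreading_norm y (\<lambda>i. if i \<in> A then a i else 0) \<le> spreading_norm y a"
proof -
  have *: "spreading_norm y (\<lambda>i. if i \<in> F then 0 else a i) \<le> spreading_norm y a" if "finite F" for F
    using that
  proof (induction F)
    case empty
    then show ?case by simp
  next
    case (insert k F)
    let ?b = "\<lambda>i. if i \<in> F then 0 else a i"
    have "fin_supp ?b" using a unfolding fin_supp_def by (rule finite_subset[rotated]) auto
    then have "spreading_norm y (?b(k := 0)) \<le> spreading_norm y ?b"
      by (rule spreading_norm_suppress1[OF y mazur])
    moreover have "?b(k := 0) = (\<lambda>i. if i \<in> insert k F then 0 else a i)" by (auto simp: fun_eq_iff)
    ultimately show ?case using insert.IH by simp
  qed
  \<comment> \<open>Restricting to \<open>A\<close>, even an infinite one, deletes only finitely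
    many nonzero coefficients, so one-step suppression can be iterated.\<close>
  have "finite ({i. a i \<noteq> 0} - A)" using a by (simp add: fin_supp_def)
  from *[OF this] show ?thesis
  proof -
    have "(\<lambda>i. if i \<in> {i. a i \<noteq> 0} - A then 0 else a i) = (\<lambda>i. if i \<in> A then a i else 0)"
      by (auto simp: fun_eq_iff)
    then show ?thesis using *[OF \<open>finite ({i. a i \<noteq> 0} - A)\<close>] by simp
  qed
qed

text \<open>Averaging the shifts of \<open>a\<close> gives an almost constant sequence, which reduces the lower
  estimate for nonnegative coefficients to constant ones.\<close>

lemma spreading_norm_lower_nonneg:
  assumes y: "asymptotically_spreading y" and mazur: "\<And>K. 0 \<in> closure (convex hull (y ` {K::nat..}))"
    and c: "\<And>n. c * real n \<le> spreading_norm y (\<lambda>i. if i < n then 1 else 0)"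
    and n: "\<forall>i\<ge>n. a i = 0" and pos: "\<And>i. 0 \<le> a i"
  shows "c * (\<Sum>i<n. a i) \<le> spreading_norm y a"
proof (rule ccontr)
  assume contr: "\<not> ?thesis"
  define S where "S = (\<Sum>i<n. a i)"
  have S: "S \<ge> 0" unfolding S_def by (intro sum_nonneg pos)
  have a: "fin_supp a" using n by (auto simp: fin_supp_iff)
  have key: "S * c * (real R - real n) \<le> real R * spreading_norm y a" if R: "R \<ge> n" for R
  proof -
    define g where "g p i = (if i < p then 0 else a (i - p))" for p i
    define b where "b i = (\<Sum>p<R. g p i)" for i
    have g: "fin_supp (g p)" for p
      unfolding fin_supp_iff g_def using n by (intro exI[of _ "n + p"]) auto
    have b: "fin_supp b" "spreading_norm y b \<le> (\<Sum>p<R. spreading_norm y (g p))"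
      unfolding b_def using spreading_norm_sum[OF y, of "{..<R}" g] g by auto
    have "spreading_norm y (g p) = spreading_norm y a" for p
      unfolding g_def by (rule spreading_norm_shift[OF y a])
    then have bR: "spreading_norm y b \<le> real R * spreading_norm y a" using b(2) by simp
    \<comment> \<open>Away from the two ends every entry of \<open>a\<close> contributes exactly
      once to the sum of shifts, which therefore equals the total mass \<open>S\<close> on n \<le> i
      < R.\<close>
    have bS: "b i = S" if i: "n \<le> i" "i < R" for i
    proof -
      have "b i = (\<Sum>p\<le>i. a (i - p))"
        unfolding b_def g_def using i by (intro sum.mono_neutral_cong_right) auto
      also have "\<dots> = (\<Sum>p\<le>i. a p)"
        by (rule sum.reindex_bij_witness[of _ "\<lambda>p. i - p" "\<lambda>p. i - p"]) auto
      also have "\<dots> = S" unfolding S_def using i n by (intro sum.mono_neutral_right) auto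
      finally show ?thesis .
    qed
    let ?one = "\<lambda>i. if i < R - n then 1 else 0 :: real"
    let ?sh = "\<lambda>i. if i < n then 0 else ?one (i - n)"
    have one: "fin_supp ?one" by (auto simp: fin_supp_iff intro!: exI[of _ "R - n"])
    have sh: "fin_supp ?sh" by (auto simp: fin_supp_iff intro!: exI[of _ R])
    have eq: "(\<lambda>i. if i \<in> {n..<R} then b i else 0) = (\<lambda>i. S * ?sh i)"
      using bS R by (auto simp: fun_eq_iff)
    \<comment> \<open>The constant stretch has length \<open>R - n\<close>. Suppression discards the
      ends of \<open>b\<close>, and shift invariance moves the stretch to the origin, where the
      hypothesis on constant coefficients applies.\<close>
    have "S * (c * real (R - n)) \<le> S * spreading_norm y ?one"
      using S c by (intro mult_left_mono) auto
    also have "\<dots> = spreading_norm y (\<lambda>i. S * ?sh i)"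
      using S by (simp only: spreading_norm_scale[OF y sh] spreading_norm_shift[OF y one] abs_of_nonneg)
    also have "\<dots> \<le> spreading_norm y b"
      using spreading_norm_suppress[OF y mazur b(1), of "{n..<R}"] by (simp only: eq)
    finally show ?thesis using bR R by (simp add: of_nat_diff mult.assoc)
  qed
  \<comment> \<open>If the estimate failed by \<open>d\<close>, then \<open>key\<close> would bound
    \<open>real R * d\<close> by the fixed number \<open>S * c * real n\<close> for all large
    R.\<close>
  define d where "d = S * c - spreading_norm y a"
  have d: "d > 0" using contr by (simp add: d_def S_def mult.commute)
  obtain R0 :: nat where R0: "S * c * real n / d < real R0" using reals_Archimedean2 by blast
  define R where "R = max n R0"
  have "real R * d \<le> S * c * real n" using key[of R] by (simp add: R_def d_def algebra_simps)
  moreover have "S * c * real n < real R0 * d" using R0 d by (simp add: pos_divide_less_eq)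
  moreover have "real R0 * d \<le> real R * d" using d by (intro mult_right_mono) (auto simp: R_def)
  ultimately show False by linarith
qed

text \<open>The positive and negative parts of \<open>a\<close> are both suppressions of
  \<open>a\<close>, so each has norm at most that of \<open>a\<close>. Adding the two lower
  estimates produces the factor 1/2.\<close>

lemma spreading_norm_lower:
  assumes y: "asymptotically_spreading y" and mazur: "\<And>K. 0 \<in> closure (convex hull (y ` {K::nat..}))"
    and c: "\<And>n. c * real n \<le> spreading_norm y (\<lambda>i. if i < n then 1 else 0)"
    and n: "\<forall>i\<ge>n. a i = 0"
  shows "c / 2 * (\<Sum>i<n. \<bar>a i\<bar>) \<le> spreading_norm y a"
proof -
  have a: "fin_supp a" using n by (auto simp: fin_supp_iff)
  let ?p = "\<lambda>i. if i \<in> {i. a i \<ge> 0} then a i else 0"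
  let ?m = "\<lambda>i. if i \<in> {i. a i < 0} then a i else 0"
  have "c * (\<Sum>i<n. ?p i) \<le> spreading_norm y ?p"
    by (rule spreading_norm_lower_nonneg[OF y mazur c]) (use n in auto)
  also have "\<dots> \<le> spreading_norm y a" by (rule spreading_norm_suppress[OF y mazur a])
  finally have p: "c * (\<Sum>i<n. ?p i) \<le> spreading_norm y a" .
  have m: "fin_supp ?m" unfolding fin_supp_iff using n by (intro exI[of _ n]) auto
  have "c * (\<Sum>i<n. -1 * ?m i) \<le> spreading_norm y (\<lambda>i. -1 * ?m i)"
    by (rule spreading_norm_lower_nonneg[OF y mazur c]) (use n in auto)
  also have "\<dots> = spreading_norm y ?m" using spreading_norm_scale[OF y m, of "-1"] by simp
  also have "\<dots> \<le> spreading_norm y a" by (rule spreading_norm_suppress[OF y mazur a])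
  finally have m: "c * (\<Sum>i<n. -1 * ?m i) \<le> spreading_norm y a" .
  have "(\<Sum>i<n. \<bar>a i\<bar>) = (\<Sum>i<n. ?p i) + (\<Sum>i<n. -1 * ?m i)"
    unfolding sum.distrib[symmetric] by (intro sum.cong) auto
  then have "c * (\<Sum>i<n. \<bar>a i\<bar>) = c * (\<Sum>i<n. ?p i) + c * (\<Sum>i<n. -1 * ?m i)"
    by (simp only: distrib_left)
  with add_mono[OF p m] have "c * (\<Sum>i<n. \<bar>a i\<bar>) \<le> spreading_norm y a + spreading_norm y a"
    by (simp only:)
  then show ?thesis by simp
qed

lemma spreading_norm_upper:
  assumes y: "asymptotically_spreading y" and B: "\<And>i. norm (y i) \<le> B" and n: "\<forall>i\<ge>n. a i = 0"
  shows "spreading_norm y a \<le> B * (\<Sum>i<n. \<bar>a i\<bar>)"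
proof (rule LIMSEQ_le_const2[OF tendsto_spreading_norm[OF y n]])
  have "norm (\<Sum>i<n. a i *\<^sub>R y (j + i)) \<le> (\<Sum>i<n. B * \<bar>a i\<bar>)" for j
    by (rule sum_norm_le) (simp add: mult.commute[of B] mult_left_mono B)
  then show "\<exists>N. \<forall>j\<ge>N. norm (\<Sum>i<n. a i *\<^sub>R y (j + i)) \<le> B * (\<Sum>i<n. \<bar>a i\<bar>)"
    by (simp add: sum_distrib_left)
qed

lemma equivalent_to_l1_basis_spreading_norm:
  assumes y: "asymptotically_spreading y" and mazur: "\<And>K. 0 \<in> closure (convex hull (y ` {K::nat..}))"
    and bdd: "bounded (range y)" and c: "c > 0"
    "\<And>n. c * real n \<le> spreading_norm y (\<lambda>i. if i < n then 1 else 0)"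
  shows "equivalent_to_l1_basis (spreading_norm y)"
proof -
  obtain B where B: "\<And>i. norm (y i) \<le> B" using bdd by (auto simp: bounded_iff)
  have eq: "(\<Sum>i<n. \<bar>if i < n then a i else 0\<bar>) = (\<Sum>i<n. \<bar>a i\<bar>)" for n :: nat and a :: "nat \<Rightarrow> real"
    by (intro sum.cong) auto
  have z: "\<forall>i\<ge>n. (if i < n then a i else 0) = 0" for n :: nat and a :: "nat \<Rightarrow> real" by simp
  show ?thesis unfolding equivalent_to_l1_basis_def
  proof (rule exI[of _ "c / 2"], rule exI[of _ B], intro conjI allI)
    fix n :: nat and a :: "nat \<Rightarrow> real"
    show "c / 2 * (\<Sum>i<n. \<bar>a i\<bar>) \<le> spreading_norm y (\<lambda>i. if i < n then a i else 0)"
      using spreading_norm_lower[OF y mazur c(2) z[of n a]] unfolding eq .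
    show "spreading_norm y (\<lambda>i. if i < n then a i else 0) \<le> B * (\<Sum>i<n. \<bar>a i\<bar>)"
      using spreading_norm_upper[OF y B z[of n a]] unfolding eq .
  qed (use c in simp)
qed

section \<open>Fixed points of cm-nonexpansive maps\<close>

lemma cm_nonexpansive_lower_estimate:
  fixes T :: "'a::real_normed_vector \<Rightarrow> 'a"
  assumes T: "cm_nonexpansive C T" and w: "\<And>i. w i \<in> C" and z: "z \<in> C"
    and afp: "(\<lambda>i. norm (T (w i) - w i)) \<longlonglongrightarrow> 0"
    and y: "asymptotically_spreading (\<lambda>i. w i - z)"
    and mazur: "\<And>K. 0 \<in> closure (convex hull ((\<lambda>i. w i - z) ` {K::nat..}))"
  shows "norm (z - T z) / 2 * real n \<le> spreading_norm (\<lambda>i. w i - z) (\<lambda>i. if i < n then 1 else 0)"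
proof -
  let ?y = "\<lambda>i. w i - z"
  let ?one = "\<lambda>i. if i < n then 1 else 0 :: real"
  define q where "q = spreading_norm ?y ?one"
  have one: "fin_supp ?one" by (auto simp: fin_supp_iff intro!: exI[of _ n])
  \<comment> \<open>Suppression gives all subsets A the same asymptotic bound \<open>q\<close>; with
    only finitely many A, the bound then holds simultaneously for late i.\<close>
  have ev: "\<forall>\<^sub>F i in sequentially. norm (\<Sum>k\<in>A. ?y (i + k)) \<le> q + \<epsilon>" if A: "A \<subseteq> {1..n}" and \<epsilon>: "\<epsilon> > 0" for A \<epsilon>
  proof -
    \<comment> \<open>Coefficients are counted from 0 but A lies in {1..n}: the element k of A is
      coefficient \<open>k - 1\<close>, and the block starts at \<open>Suc i\<close>.\<close>
    let ?a = "\<lambda>i. if i \<in> {i. Suc i \<in> A} then ?one i else 0"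
    have "(\<lambda>i. norm (\<Sum>j<n. ?a j *\<^sub>R ?y (Suc i + j))) \<longlonglongrightarrow> spreading_norm ?y ?a"
      by (rule LIMSEQ_Suc[OF tendsto_spreading_norm[OF y, of n ?a]]) simp
    moreover have "(\<Sum>j<n. ?a j *\<^sub>R ?y (Suc i + j)) = (\<Sum>k\<in>A. ?y (i + k))" for i
    proof -
      have "(\<Sum>j<n. ?a j *\<^sub>R ?y (Suc i + j)) = (\<Sum>j\<in>{j. Suc j \<in> A}. ?y (Suc i + j))"
        using A by (intro sum.mono_neutral_cong_right) auto
      also have "\<dots> = (\<Sum>k\<in>A. ?y (i + k))"
        using A by (intro sum.reindex_bij_witness[of _ "\<lambda>k. k - 1" Suc]) auto
      finally show ?thesis .
    qed
    ultimately have "(\<lambda>i. norm (\<Sum>k\<in>A. ?y (i + k))) \<longlonglongrightarrow> spreading_norm ?y ?a" by (simp only:)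
    moreover have "spreading_norm ?y ?a \<le> q" unfolding q_def by (rule spreading_norm_suppress[OF y mazur one])
    then have "spreading_norm ?y ?a < q + \<epsilon>" using \<epsilon> by simp
    ultimately have "\<forall>\<^sub>F i in sequentially. norm (\<Sum>k\<in>A. ?y (i + k)) < q + \<epsilon>" by (rule order_tendstoD)
    then show ?thesis by eventually_elim simp
  qed
  have "real n * norm (z - T z) \<le> 2 * q"
  proof (rule field_le_epsilon)
    fix e :: real assume "e > 0"
    \<comment> \<open>The four quarters are spent as two on the sum of
      \<open>T (w (i + k)) - T z\<close>, one on the displacements
      \<open>T (w (i + k)) - w (i + k)\<close>, and one on the sum of
      \<open>w (i + k) - z\<close>.\<close>
    define \<epsilon> where "\<epsilon> = e / 4"
    have \<epsilon>: "\<epsilon> > 0" using \<open>e > 0\<close> by (simp add: \<epsilon>_def)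
    have "\<forall>\<^sub>F i in sequentially. \<forall>A\<in>Pow {1..n}. norm (\<Sum>k\<in>A. ?y (i + k)) \<le> q + \<epsilon>"
      using ev[OF _ \<epsilon>] by (intro eventually_ball_finite) auto
    then have "\<forall>\<^sub>F i in sequentially. ereal (Max ((\<lambda>A. norm (\<Sum>k\<in>A. id (w (i + k)) - id z)) ` Pow {1..n})) \<le> ereal (q + \<epsilon>)"
    proof eventually_elim
      case (elim i)
      then have "Max ((\<lambda>A. norm (\<Sum>k\<in>A. id (w (i + k)) - id z)) ` Pow {1..n}) \<le> q + \<epsilon>"
        by (intro Max.boundedI) auto
      then show ?case by simp
    qed
    then have "cm_quantity id w z n \<le> ereal (q + \<epsilon>)" unfolding cm_quantity_def by (rule Limsup_bounded)
    moreover have "cm_quantity T w z n \<le> cm_quantity id w z n"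
      using T w z unfolding cm_nonexpansive_def by blast
    \<comment> \<open>The second \<epsilon> makes the bound on the limsup strict, so that it passes
      to the late terms of the sequence.\<close>
    moreover have "ereal (q + \<epsilon>) < ereal (q + 2 * \<epsilon>)" using \<epsilon> by simp
    ultimately have "cm_quantity T w z n < ereal (q + 2 * \<epsilon>)" by (meson le_less_trans)
    then have E1: "\<forall>\<^sub>F i in sequentially. ereal (Max ((\<lambda>A. norm (\<Sum>k\<in>A. T (w (i + k)) - T z)) ` Pow {1..n})) < ereal (q + 2 * \<epsilon>)"
      unfolding cm_quantity_def by (rule Limsup_lessD)
    have E2: "\<forall>\<^sub>F i in sequentially. norm (\<Sum>k\<in>{1..n}. ?y (i + k)) \<le> q + \<epsilon>"
      by (rule ev[OF order_refl \<epsilon>])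
    have "(\<lambda>i. \<Sum>k\<in>{1..n}. norm (T (w (i + k)) - w (i + k))) \<longlonglongrightarrow> (\<Sum>k\<in>{1..n}. 0)"
      by (intro tendsto_sum LIMSEQ_ignore_initial_segment[OF afp])
    then have E3: "\<forall>\<^sub>F i in sequentially. (\<Sum>k\<in>{1..n}. norm (T (w (i + k)) - w (i + k))) < \<epsilon>"
      by (rule order_tendstoD) (use \<epsilon> in simp)
    from eventually_happens'[OF sequentially_bot eventually_conj[OF E1 eventually_conj[OF E2 E3]]]
    obtain i where i: "Max ((\<lambda>A. norm (\<Sum>k\<in>A. T (w (i + k)) - T z)) ` Pow {1..n}) < q + 2 * \<epsilon>"
      "norm (\<Sum>k\<in>{1..n}. ?y (i + k)) \<le> q + \<epsilon>"
      "(\<Sum>k\<in>{1..n}. norm (T (w (i + k)) - w (i + k))) < \<epsilon>" by auto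
    have 1: "norm (\<Sum>k\<in>{1..n}. T (w (i + k)) - T z) \<le> q + 2 * \<epsilon>"
      by (rule order_trans[OF Max_ge less_imp_le[OF i(1)]]) auto
    have 3: "norm (\<Sum>k\<in>{1..n}. T (w (i + k)) - w (i + k)) \<le> \<epsilon>"
      using norm_sum[of "\<lambda>k. T (w (i + k)) - w (i + k)" "{1..n}"] i(3) by linarith
    \<comment> \<open>In each summand \<open>T w - T z - (T w - w) - (w - z)\<close> equals
      \<open>z - T z\<close>. The full set A = {1..n} is the instance of the maximum that is
      used.\<close>
    have "real n *\<^sub>R (z - T z) = (\<Sum>k\<in>{1..n}. z - T z)" by (simp add: sum_constant_scaleR)
    also have "\<dots> = (\<Sum>k\<in>{1..n}. T (w (i + k)) - T z)
        - (\<Sum>k\<in>{1..n}. T (w (i + k)) - w (i + k)) - (\<Sum>k\<in>{1..n}. ?y (i + k))"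
      unfolding sum_subtractf[symmetric] by (intro sum.cong) (auto simp: algebra_simps)
    finally have "norm (real n *\<^sub>R (z - T z)) = norm ((\<Sum>k\<in>{1..n}. T (w (i + k)) - T z)
        - (\<Sum>k\<in>{1..n}. T (w (i + k)) - w (i + k)) - (\<Sum>k\<in>{1..n}. ?y (i + k)))"
      by (rule arg_cong)
    also have "\<dots> \<le> norm (\<Sum>k\<in>{1..n}. T (w (i + k)) - T z)
        + norm (\<Sum>k\<in>{1..n}. T (w (i + k)) - w (i + k)) + norm (\<Sum>k\<in>{1..n}. ?y (i + k))"
      by (rule order_trans[OF norm_triangle_ineq4 add_right_mono[OF norm_triangle_ineq4]])
    also have "\<dots> \<le> 2 * q + e" using 1 3 i(2) unfolding \<epsilon>_def by linarith
    finally show "real n * norm (z - T z) \<le> 2 * q + e" by simp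
  qed
  then show ?thesis by (simp add: q_def mult.commute)
qed

lemma not_weak_FPP_cm_imp_l1_spreading_model:
  fixes X :: "'a::banach set"
  assumes X: "subspace X" and fail: "\<not> weak_FPP_cm X"
  shows "has_l1_spreading_model X"
proof -
  obtain C T where C: "C \<subseteq> X" "C \<noteq> {}" "convex C" "compactin (weak_topology_on X) C"
    and T: "cm_nonexpansive C T" and no_fix: "\<And>x. x \<in> C \<Longrightarrow> T x \<noteq> x"
    using fail unfolding weak_FPP_cm_def by blast
  have bC: "bounded C" using T by (simp add: cm_nonexpansive_def)
  obtain u where u: "range u \<subseteq> C" "(\<lambda>n::nat. norm (T (u n) - u n)) \<longlonglongrightarrow> 0"
    using approximate_fixed_points[OF weakly_compact_imp_closed[OF C(4)] C(3) bC C(2), of T] T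
    unfolding cm_nonexpansive_def by blast
  obtain s :: "nat \<Rightarrow> nat" and z where s: "strict_mono s" and z: "z \<in> C"
    and hull: "\<And>r K. strict_mono r \<Longrightarrow> z \<in> closure (convex hull ((\<lambda>n. u (s (r n))) ` {K::nat..}))"
    using weakly_compact_subsequence_tail_hulls[OF C(4) bC u(1)] by blast
  define x where "x n = u (s n) - z" for n
  have uC: "u n \<in> C" for n using u(1) by blast
  have bx: "bounded (range x)"
  proof -
    obtain B where "\<And>v. v \<in> C \<Longrightarrow> norm v \<le> B" using bC by (auto simp: bounded_iff)
    then have "norm (x n) \<le> B + B" for n
      using norm_triangle_ineq4[of "u (s n)" z] add_mono[of "norm (u (s n))" B "norm z" B] uC z
      unfolding x_def by (meson order_trans)
    then show ?thesis by (auto simp: bounded_iff)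
  qed
  obtain r where r: "strict_mono r" "asymptotically_spreading (\<lambda>i. x (r i))"
    using Brunel_Sucheston[OF bx] by blast
  \<comment> \<open>Here the quantifier over all further subsequences pays off: the hull property of
    z holds along \<open>s\<close> composed with the newly found \<open>r\<close>, and translation
    by \<open>- z\<close> turns it into a statement about 0.\<close>
  have mazur: "0 \<in> closure (convex hull ((\<lambda>i. x (r i)) ` {K::nat..}))" for K
  proof -
    have eq: "(\<lambda>i. x (r i)) ` {K..} = (+) (- z) ` ((\<lambda>n. u (s (r n))) ` {K..})"
      by (simp add: image_image x_def)
    have "closure (convex hull ((\<lambda>i. x (r i)) ` {K..})) =
        (+) (- z) ` closure (convex hull ((\<lambda>n. u (s (r n))) ` {K..}))"
      unfolding eq convex_hull_translation closure_translation ..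
    moreover have "- z + z \<in> (+) (- z) ` closure (convex hull ((\<lambda>n. u (s (r n))) ` {K..}))"
      by (intro imageI hull r)
    ultimately show ?thesis by simp
  qed
  have "strict_mono (\<lambda>i. s (r i))" using s r(1) by (simp add: strict_mono_def)
  from LIMSEQ_subseq_LIMSEQ[OF u(2) this]
  have afp: "(\<lambda>i. norm (T (u (s (r i))) - u (s (r i)))) \<longlonglongrightarrow> 0" by (simp add: o_def)
  have "equivalent_to_l1_basis (spreading_norm (\<lambda>i. x (r i)))"
  proof (rule equivalent_to_l1_basis_spreading_norm[OF r(2) mazur])
    show "bounded (range (\<lambda>i. x (r i)))" by (rule bounded_subset[OF bx]) auto
    \<comment> \<open>Since z belongs to C, the absence of fixed points makes the displacement of z
      itself nonzero; this is the source of the l1 constant.\<close>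
    show "norm (z - T z) / 2 > 0" using no_fix[OF z] by auto
    show "norm (z - T z) / 2 * real n \<le> spreading_norm (\<lambda>i. x (r i)) (\<lambda>i. if i < n then 1 else 0)" for n
      using cm_nonexpansive_lower_estimate[OF T, of "\<lambda>i. u (s (r i))" z n] uC z afp r(2) mazur
      unfolding x_def by blast
  qed
  moreover have "range x \<subseteq> X"
    using C(1) uC z by (auto simp: x_def intro!: subspace_diff[OF X])
  ultimately show ?thesis
    unfolding has_l1_spreading_model_def
    using bx generates_spreading_model_spreading_norm[of r x, OF r] by blast
qed

theorem mainTheorem1:
  fixes P :: "'d \<Rightarrow> 'a::banach \<Rightarrow> 'a" and D :: "'d set" and le :: "'d \<Rightarrow> 'd \<Rightarrow> bool"
    and lam :: real and X :: "'a set"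
  assumes "is_EAB lam D le P" and "lam < 2"
    and "subspace X" and "closed X"
    and "\<not> weak_FPP_cm X"
  shows "has_l1_spreading_model X"
  using not_weak_FPP_cm_imp_l1_spreading_model assms(3,5) .

end
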